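(* The peak functions $\theta_{S,u}$ indexed by admissible pairs $(S,u)$ form a basis of $\mathcal O^{\boldsymbol\infty}$. Moreover, if $\mathbf I$ is a vector composition all of whose columns have odd weight and $u=\mathrm{cw}(\mathbf I)$, then \[\eta_{\mathbf I}=\sum_{S\subseteq\mathrm{Pk}(\widetilde{\mathbf I})}(-1)^{|S|}\theta_{S,u},\] and for every admissible pair $(S,u)$, \[\theta_{S,u}=\sum_{T\subseteq S}(-1)^{|T|}\eta_{\mathrm{odd}(\mathbf I_{T,u})}.\]
   Context: Fix $\ell\ge1$; $|\mathbf n|=\sum n_i$; $\mathbf e_c$ coordinate vectors. Vector composition: sequence $\mathbf I=(\mathbf i_1,\dots,\mathbf i_m)$ of nonzero elements of $\mathbb N^\ell$; $\mathrm{len}(\mathbf I)=m$; $\Sigma\mathbf I=\sum\mathbf i_r$. $\mathbf J\trianglelefteq\mathbf I$: $\mathbf J$ obtained from $\mathbf I$ by adding together groups of consecutive columns. $D(\mathbf I)=\{|\mathbf i_1|,\dots,|\mathbf i_1|+\dots+|\mathbf i_{m-1}|\}$, $D+1=\{s+1:s\in D\}$, $\mathrm{Pk}(\mathbf I)=\{|\mathbf i_1|+\dots+|\mathbf i_r|:1\le r\le m-1,\ |\mathbf i_r|\ge2\}$. Coloring word $\mathrm{cw}(\mathbf I)$: read columns left to right, writing in column $\mathbf i_r$ the color $c$ repeated ($c$-th entry) times for $c=0,\dots,\ell-1$. For $u=u_1\cdots u_n\in\{0,\dots,\ell-1\}^n$, $\mathbf E_u=(\mathbf e_{u_1},\dots,\mathbf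 e_{u_n})$. If the last column of $\mathbf I$ has odd weight, $\mathbf I=\mathbf I_1\cdots\mathbf I_p$ uniquely with each $\mathbf I_j$ having odd-weight last column and even-weight other columns, and $\mathrm{odd}(\mathbf I)=(\Sigma\mathbf I_1,\dots,\Sigma\mathbf I_p)$. For $\mathbf I$ with all columns of odd weight, $\widetilde{\mathbf I}$ is the vector composition with the same coloring word obtained by replacing each column by a vector composition of it whose columns have weight $2$ except the last, of weight $1$. A peak subset of $[n]$ is $S\subseteq\{2,\dots,n-1\}$ with $i\in S\Rightarrow i-1\notin S$. For such $S$ and $u$ of length $n$, $\mathbf I_{S,u}$ is the unique vector composition with all columns of weight $1$ or $2$, coloring word $u$ and $\mathrm{Pk}(\mathbf I_{S,u})=S$; $(S,u)$ is admissible if $\mathrm{cw}(\mathrm{odd}(\mathbf I_{S,u}))=u$. $\mathrm{QSym}^{(\ell)}$: $\mathbb Q$-span of $M_{\mathbf I}=\sum_{j_1<\dots<j_m}\mathbf x_{j_1}^{\mathbf i_1}\cdots\mathbf x_{j_m}^{\mathbf i_m}$ in commuting variables $x_j^{(i)}$ ($\mathbf x_j^{\mathbf n}=\prod_i(x_j^{(i)})^{n_i}$), graded Hopf algebra with deconcatenation coproduct; $\eta_{\mathbf I}=\sum_{\mathbf J\trianglelefteq\mathbf I}2^{\mathrm{len}(\mathbf J)}M_{\mathbf J}$; $\theta_{S,u}=\sum_{\mathbf J\trianglelefteq\mathbf E_u,\ S\subseteq D(\mathbf J)\cup(D(\mathbf J)+1)}2^{\mathrm{len}(\mathbf J)}M_{\mathbf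 J}$. $\zeta_{\mathcal Q}(M_{\mathbf I})=1$ if $\mathrm{len}(\mathbf I)\le1$, else $0$; $\bar\zeta_{\mathcal Q}(h)=(-1)^{|\mathbf n|}\zeta_{\mathcal Q}(h)$ on degree $\mathbf n$; $\mathcal O^{\boldsymbol\infty}$ is the largest graded subcoalgebra $C$ of $\mathrm{QSym}^{(\ell)}$ with $\bar\zeta_{\mathcal Q}(h)=\zeta_{\mathcal Q}^{-1}(h)$ for all $h\in C$ ($\zeta_{\mathcal Q}^{-1}$ the convolution inverse).
   Formalization: I_{S,u} as described need not be unique (u=00, S=∅: both (e_0,e_0) and (2e_0)) or exist (u=100, S={2}); here its last column is required to have odd weight, so that odd(I_{S,u}) is defined, and existence of I_{S,u} is part of admissibility. *)

theory Defs
  imports Complex_Main "HOL-Library.Poly_Mapping" "HOL-Library.Function_Algebras"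
begin

section \<open>Vector compositions\<close>

text \<open>
  An element of \<open>\<nat>\<^sup>l\<close> is a finitely supported map from colors to \<open>\<nat>\<close> whose support lies in
  \<open>{0,...,l-1}\<close>. The number \<open>l\<close> of colors enters only through the carriers.
\<close>

type_synonym cvec = "nat \<Rightarrow>\<^sub>0 nat"
type_synonym vcomp = "cvec list"
type_synonym color_word = "nat list"

definition wt :: "cvec \<Rightarrow> nat" where
  "wt v = (\<Sum>c\<in>Poly_Mapping.keys v. Poly_Mapping.lookup v c)"

definition vcomps :: "nat \<Rightarrow> vcomp set" where
  "vcomps l = {I. \<forall>i\<in>set I. i \<noteq> 0 \<and> Poly_Mapping.keys i \<subseteq> {..<l}}"

definition coarsens :: "vcomp \<Rightarrow> vcomp \<Rightarrow> bool"  (infix \<open>\<unlhd>\<close> 50) where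
  "J \<unlhd> I \<longleftrightarrow> (\<exists>Bs. concat Bs = I \<and> [] \<notin> set Bs \<and> J = map sum_list Bs)"

definition partial_wt :: "vcomp \<Rightarrow> nat \<Rightarrow> nat" where
  "partial_wt I r = (\<Sum>i\<leftarrow>take r I. wt i)"

definition D :: "vcomp \<Rightarrow> nat set" where
  "D I = {partial_wt I r |r. 1 \<le> r \<and> r < length I}"

text \<open>The \<open>r\<close>-th column, counted from \<open>1\<close>, is \<open>I ! (r - 1)\<close>.\<close>

definition Pk :: "vcomp \<Rightarrow> nat set" where
  "Pk I = {partial_wt I r |r. 1 \<le> r \<and> r < length I \<and> wt (I ! (r - 1)) \<ge> 2}"

definition cw :: "vcomp \<Rightarrow> color_word" where
  "cw I = concat (map (\<lambda>i. concat (map (\<lambda>c. replicate (Poly_Mapping.lookup i c) c)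
                             (sorted_list_of_set (Poly_Mapping.keys i)))) I)"

definition E :: "color_word \<Rightarrow> vcomp" where
  "E u = map (\<lambda>c. Poly_Mapping.single c 1) u"

definition odd_blocks :: "vcomp \<Rightarrow> vcomp list \<Rightarrow> bool" where
  "odd_blocks I Bs \<longleftrightarrow> concat Bs = I \<and>
     (\<forall>B\<in>set Bs. B \<noteq> [] \<and> odd (wt (last B)) \<and> (\<forall>i\<in>set (butlast B). even (wt i)))"

text \<open>Meaningful if the last column has odd weight; for the empty composition the value is empty.\<close>

definition odd_comp :: "vcomp \<Rightarrow> vcomp" where
  "odd_comp I = map sum_list (THE Bs. odd_blocks I Bs)"

text \<open>\<open>is_tilde I K\<close>: the composition \<open>K\<close> is the one denoted by \<open>I\<close> with a tilde.\<close>

definition is_tilde :: "vcomp \<Rightarrow> vcomp \<Rightarrow> bool" where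
  "is_tilde I K \<longleftrightarrow> cw K = cw I \<and>
     (\<exists>Bs. K = concat Bs \<and>
        list_all2 (\<lambda>i B. sum_list B = i \<and> B \<noteq> [] \<and>
                     (\<forall>b\<in>set (butlast B). wt b = 2) \<and> wt (last B) = 1) I Bs)"

definition tilde :: "vcomp \<Rightarrow> vcomp" where
  "tilde I = (THE K. is_tilde I K)"

definition peak_subset :: "nat \<Rightarrow> nat set \<Rightarrow> bool" where
  "peak_subset n S \<longleftrightarrow> S \<subseteq> {2..n - 1} \<and> (\<forall>i\<in>S. i - 1 \<notin> S)"

text \<open>
  \<open>Pk\<close> does not see the weight of the last column. Since \<open>odd_comp\<close> is to be applied to
  \<open>I\<^bsub>S,u\<^esub>\<close>, its last column has odd weight; with this requirement there is at most one such
  composition. There is none if the letters of \<open>u\<close> in positions \<open>s - 1\<close>, \<open>s\<close> decrease for some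
  \<open>s \<in> S\<close>, because a coloring word is weakly increasing inside each column; such a pair
  \<open>(S, u)\<close> is not admissible.
\<close>

definition is_peak_comp :: "nat set \<Rightarrow> color_word \<Rightarrow> vcomp \<Rightarrow> bool" where
  "is_peak_comp S u I \<longleftrightarrow> (\<forall>i\<in>set I. wt i = 1 \<or> wt i = 2) \<and> cw I = u \<and> Pk I = S \<and>
     (I \<noteq> [] \<longrightarrow> odd (wt (last I)))"

definition peak_comp :: "nat set \<Rightarrow> color_word \<Rightarrow> vcomp" where
  "peak_comp S u = (THE I. is_peak_comp S u I)"

definition admissible :: "nat \<Rightarrow> (nat set \<times> color_word) set" where
  "admissible l = {(S, u). set u \<subseteq> {..<l} \<and> peak_subset (length u) S \<and>
     (\<exists>I. is_peak_comp S u I) \<and> cw (odd_comp (peak_comp S u)) = u}"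


section \<open>Quasisymmetric functions in \<open>l\<close> sets of variables\<close>

text \<open>
  A monomial in the variables \<open>x\<^sub>j\<^sup>(\<^sup>c\<^sup>)\<close> is given by the exponent vector of \<open>\<^bold>x\<^sub>j\<close> for every \<open>j\<close>,
  so that \<open>\<^bold>x\<^sub>j\<^sup>n\<close> is \<open>Poly_Mapping.single j n\<close> and \<open>+\<close> multiplies monomials. The indices \<open>j\<close>
  start from \<open>0\<close>. Formal power series are families of coefficients; addition of series is the
  pointwise one of \<^theory>\<open>HOL-Library.Function_Algebras\<close>, whose pointwise product is not used.
\<close>

type_synonym xmonom = "nat \<Rightarrow>\<^sub>0 cvec"
type_synonym series = "xmonom \<Rightarrow> rat"

definition scl :: "rat \<Rightarrow> ('a \<Rightarrow> rat) \<Rightarrow> 'a \<Rightarrow> rat" where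
  "scl a f = (\<lambda>m. a * f m)"

global_interpretation fs: vector_space "scl :: rat \<Rightarrow> ('a \<Rightarrow> rat) \<Rightarrow> 'a \<Rightarrow> rat"
  by unfold_locales (auto simp: scl_def fun_eq_iff algebra_simps)

definition xmono :: "nat list \<Rightarrow> vcomp \<Rightarrow> xmonom" where
  "xmono js I = (\<Sum>r<length I. Poly_Mapping.single (js ! r) (I ! r))"

definition M :: "vcomp \<Rightarrow> series" where
  "M I = (\<lambda>m. of_nat (card {js. length js = length I \<and> sorted_wrt (<) js \<and> xmono js I = m}))"

definition QSym :: "nat \<Rightarrow> series set" where
  "QSym l = fs.span (M ` vcomps l)"

definition QSym_deg :: "nat \<Rightarrow> cvec \<Rightarrow> series set" where
  "QSym_deg l n = fs.span (M ` {I \<in> vcomps l. sum_list I = n})"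

definition eta :: "vcomp \<Rightarrow> series" where
  "eta I = (\<Sum>J | J \<unlhd> I. scl (2 ^ length J) (M J))"

definition theta :: "nat set \<Rightarrow> color_word \<Rightarrow> series" where
  "theta S u = (\<Sum>J | J \<unlhd> E u \<and> S \<subseteq> D J \<union> Suc ` D J. scl (2 ^ length J) (M J))"


section \<open>The coalgebra structure\<close>

text \<open>
  The coefficient of \<open>M I\<close> in a quasisymmetric function is its coefficient at the monomial
  \<open>\<^bold>x\<^sub>0\<^bsup>i\<^sub>1\<^esup> \<^bold>x\<^sub>1\<^bsup>i\<^sub>2\<^esup> \<dots>\<close>; see lemma \<open>M_coeff_M\<close> below.
\<close>

definition M_coeff :: "series \<Rightarrow> vcomp \<Rightarrow> rat" where
  "M_coeff h I = h (xmono [0..<length I] I)"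

definition M_supp :: "series \<Rightarrow> vcomp set" where
  "M_supp h = {I. 0 \<notin> set I \<and> M_coeff h I \<noteq> 0}"

text \<open>The linear functional on quasisymmetric functions with value \<open>\<phi> I\<close> on \<open>M I\<close>.\<close>

definition M_functional :: "(vcomp \<Rightarrow> rat) \<Rightarrow> series \<Rightarrow> rat" where
  "M_functional \<phi> h = (\<Sum>I\<in>M_supp h. M_coeff h I * \<phi> I)"

text \<open>
  Tensors are realised as power series in two independent sets of variables; \<open>f \<otimes> g\<close> becomes the
  product \<open>f(x) g(y)\<close>, which embeds the algebraic tensor product.
\<close>

definition tensor :: "series \<Rightarrow> series \<Rightarrow> xmonom \<times> xmonom \<Rightarrow> rat" where
  "tensor f g = (\<lambda>(p, q). f p * g q)"

definition tensor_square :: "series set \<Rightarrow> (xmonom \<times> xmonom \<Rightarrow> rat) set" where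
  "tensor_square C = fs.span {tensor f g |f g. f \<in> C \<and> g \<in> C}"

definition coprod :: "series \<Rightarrow> xmonom \<times> xmonom \<Rightarrow> rat" where
  "coprod h = (\<Sum>I\<in>M_supp h. scl (M_coeff h I)
                 (\<Sum>k\<le>length I. tensor (M (take k I)) (M (drop k I))))"

definition counit :: "series \<Rightarrow> rat" where
  "counit = M_functional (\<lambda>I. if I = [] then 1 else 0)"

text \<open>The convolution \<open>(f \<otimes> g) \<circ> coprod\<close> of linear functionals.\<close>

definition conv :: "(series \<Rightarrow> rat) \<Rightarrow> (series \<Rightarrow> rat) \<Rightarrow> series \<Rightarrow> rat" where
  "conv f g = M_functional (\<lambda>I. \<Sum>k\<le>length I. f (M (take k I)) * g (M (drop k I)))"

definition linear_on_QSym :: "nat \<Rightarrow> (series \<Rightarrow> rat) \<Rightarrow> bool" where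
  "linear_on_QSym l f \<longleftrightarrow>
     (\<forall>h\<in>QSym l. \<forall>k\<in>QSym l. f (h + k) = f h + f k) \<and>
     (\<forall>a. \<forall>h\<in>QSym l. f (scl a h) = a * f h)"

definition conv_inverse :: "nat \<Rightarrow> (series \<Rightarrow> rat) \<Rightarrow> (series \<Rightarrow> rat) \<Rightarrow> bool" where
  "conv_inverse l f g \<longleftrightarrow> linear_on_QSym l g \<and>
     (\<forall>h\<in>QSym l. conv f g h = counit h \<and> conv g f h = counit h)"

definition zetaQ :: "series \<Rightarrow> rat" where
  "zetaQ = M_functional (\<lambda>I. if length I \<le> 1 then 1 else 0)"

text \<open>The values of \<open>zetaQ_inv l\<close> on \<open>QSym l\<close> do not depend on the choice.\<close>

definition zetaQ_inv :: "nat \<Rightarrow> series \<Rightarrow> rat" where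
  "zetaQ_inv l = (SOME g. conv_inverse l zetaQ g)"

definition deg_part :: "cvec \<Rightarrow> series \<Rightarrow> series" where
  "deg_part n h = (\<Sum>I\<in>{I \<in> M_supp h. sum_list I = n}. scl (M_coeff h I) (M I))"

definition zetaQ_bar :: "series \<Rightarrow> rat" where
  "zetaQ_bar h = (\<Sum>n\<in>sum_list ` M_supp h. (- 1) ^ wt n * zetaQ (deg_part n h))"

definition graded_subcoalgebra :: "nat \<Rightarrow> series set \<Rightarrow> bool" where
  "graded_subcoalgebra l C \<longleftrightarrow>
     fs.subspace C \<and> C \<subseteq> QSym l \<and>
     C = fs.span (\<Union>n. C \<inter> QSym_deg l n) \<and>
     coprod ` C \<subseteq> tensor_square C"

definition O_infty :: "nat \<Rightarrow> series set" where
  "O_infty l = (GREATEST C. graded_subcoalgebra l C \<and> (\<forall>h\<in>C. zetaQ_bar h = zetaQ_inv l h))"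


subsection \<open>Values on the monomial basis\<close>

lemma lookup_xmono:
  assumes "sorted_wrt (<) js" "length js = length I" "r < length I"
  shows "Poly_Mapping.lookup (xmono js I) (js ! r) = I ! r"
proof -
  have d: "distinct js"
    using assms(1) by (simp add: strict_sorted_iff)
  have "Poly_Mapping.lookup (xmono js I) (js ! r) =
        (\<Sum>s<length I. if s = r then I ! s else 0)"
    unfolding xmono_def lookup_sum
    using d assms by (intro sum.cong) (auto simp: lookup_single when_def nth_eq_iff_index_eq)
  then show ?thesis
    using assms by simp
qed

lemma keys_xmono:
  assumes "sorted_wrt (<) js" "length js = length I" "0 \<notin> set I"
  shows "Poly_Mapping.keys (xmono js I) = set js"
proof
  show "Poly_Mapping.keys (xmono js I) \<subseteq> set js"
  proof
    fix j assume j: "j \<in> Poly_Mapping.keys (xmono js I)"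
    show "j \<in> set js"
    proof (rule ccontr)
      assume "j \<notin> set js"
      then have "Poly_Mapping.lookup (xmono js I) j = 0"
        unfolding xmono_def lookup_sum using assms(2)
        by (intro sum.neutral) (auto simp: lookup_single when_def)
      with j show False
        by (simp add: in_keys_iff)
    qed
  qed
  show "set js \<subseteq> Poly_Mapping.keys (xmono js I)"
  proof
    fix j assume "j \<in> set js"
    then obtain r where "r < length js" "j = js ! r"
      by (auto simp: in_set_conv_nth)
    with lookup_xmono[of js I r] assms show "j \<in> Poly_Mapping.keys (xmono js I)"
      by (auto simp: in_keys_iff) (metis nth_mem)
  qed
qed

lemma xmono_inject:
  assumes "sorted_wrt (<) js" "length js = length I" "0 \<notin> set I"
    and "sorted_wrt (<) ks" "length ks = length J" "0 \<notin> set J"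
  shows "xmono js I = xmono ks J \<longleftrightarrow> js = ks \<and> I = J"
proof
  assume eq: "xmono js I = xmono ks J"
  then have "set js = set ks"
    using keys_xmono assms by metis
  then have js: "js = ks"
    using assms by (intro strict_sorted_equal) auto
  moreover have "I = J"
    using js eq assms lookup_xmono by (intro nth_equalityI) metis+
  ultimately show "js = ks \<and> I = J" ..
qed simp

lemma M_coeff_M:
  assumes "0 \<notin> set I" "0 \<notin> set J"
  shows "M_coeff (M I) J = (if I = J then 1 else 0)"
proof -
  have "{js. length js = length I \<and> sorted_wrt (<) js \<and> xmono js I = xmono [0..<length J] J} =
        (if I = J then {[0..<length J]} else {})"
    using xmono_inject[of _ I "[0..<length J]" J] assms by auto
  then show ?thesis
    by (simp add: M_coeff_def M_def)
qed

lemma M_supp_M: "0 \<notin> set I \<Longrightarrow> M_supp (M I) = {I}"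
  by (auto simp: M_supp_def M_coeff_M split: if_splits)

lemma coprod_M:
  "0 \<notin> set I \<Longrightarrow> coprod (M I) = (\<Sum>k\<le>length I. tensor (M (take k I)) (M (drop k I)))"
  by (simp add: coprod_def M_supp_M M_coeff_M)

lemma M_functional_M: "0 \<notin> set I \<Longrightarrow> M_functional \<phi> (M I) = \<phi> I"
  by (simp add: M_functional_def M_supp_M M_coeff_M)

end

theory Submission
  imports Defs "HOL-Library.Multiset"
begin

text \<open>
  A composition \<open>I\<close> with odd columns is encoded by the pair of \<open>Pk(\<close>\<open>I\<close>-tilde\<open>)\<close> and \<open>cw(I)\<close>; the
  admissible pairs are exactly the pairs that arise, and \<open>(S, u) \<mapsto> odd(I\<^bsub>S,u\<^esub>)\<close> is the inverse
  encoding. A coarsening \<open>J\<close> of \<open>E\<^sub>u\<close> is a coarsening of \<open>I\<close> if and only if no peak of \<open>I\<close>-tilde lies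
  in \<open>D(J) \<union> (D(J) + 1)\<close>, so both expansions are instances of inclusion-exclusion.

  It remains to see that the \<open>\<eta>\<^sub>I\<close> with odd columns form a basis of the coalgebra. They span a
  graded subcoalgebra on which the two functionals agree. Conversely, contracting the coproduct of
  an element \<open>h\<close> of any such subcoalgebra shows that, for all \<open>A\<close>, \<open>B\<close> and \<open>m \<noteq> 0\<close>, the sum of
  \<open>(-1)\<^bsup>len J\<^esup> h(A J B)\<close> over the compositions \<open>J\<close> of \<open>m\<close> equals \<open>(-1)\<^bsup>|m|\<^esup> h(A m B)\<close>, where \<open>h(I)\<close>
  is the coefficient of \<open>M\<^sub>I\<close>. For even \<open>|m|\<close> this determines \<open>h\<close> by its values at compositions with
  odd columns, on which the \<open>\<eta>\<^sub>I\<close> are triangular.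
\<close>

section \<open>Columns and words\<close>

text \<open>Compositions are handled through the words of their columns. The word of a column is
  sorted, so cutting and gluing columns is cutting and gluing lists subject to sortedness: gluing a
  pair of letters to what follows can break it, and admissibility of (S, u) says that this does not
  happen. Dropping peaks only cuts further, hence admissible pairs are closed under passing to
  subsets of S, and the signed sums stay within the admissible range.

  The two expansions invert each other because \<open>eta\<close> asks that no peak be covered by
  D(J) and D(J) + 1, \<open>theta\<close> that all of S be covered, and a signed sum over the
  subsets of a finite set vanishes unless that set is empty.

  The factor 2^len balances the two functionals: for nonempty I the signed sum over all coarsenings
  is 2 (-1)^len(I), while the single coarsening with one column n contributes 2 (-1)^|n|. For odd
  columns these signs agree. In the maximality argument the grading isolates one m, as the
  contraction of an inhomogeneous h mixes several degrees.\<close>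

lemma wt_superset:
  assumes "finite A" "Poly_Mapping.keys v \<subseteq> A"
  shows "wt v = (\<Sum>c\<in>A. Poly_Mapping.lookup v c)"
  unfolding wt_def using assms
  by (intro sum.mono_neutral_left) (auto simp: in_keys_iff)

lemma wt_zero [simp]: "wt 0 = 0"
  by (simp add: wt_def)

lemma wt_add [simp]: "wt (v + w) = wt v + wt w"
proof -
  let ?A = "Poly_Mapping.keys v \<union> Poly_Mapping.keys w"
  have "wt (v + w) = (\<Sum>c\<in>?A. Poly_Mapping.lookup (v + w) c)"
    using Poly_Mapping.keys_add[of v w] by (intro wt_superset) auto
  also have "\<dots> = wt v + wt w"
    by (simp add: lookup_add sum.distrib wt_superset[of ?A v] wt_superset[of ?A w])
  finally show ?thesis .
qed

lemma wt_sum_list: "wt (sum_list I) = (\<Sum>i\<leftarrow>I. wt i)"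
  by (induction I) auto

lemma wt_eq_0_iff [simp]: "wt v = 0 \<longleftrightarrow> v = 0"
proof
  assume "wt v = 0"
  then show "v = 0"
    by (intro poly_mapping_eqI) (auto simp: wt_def in_keys_iff)
qed simp

lemma wt_pos: "v \<noteq> 0 \<Longrightarrow> wt v \<ge> 1"
  using wt_eq_0_iff[of v] by linarith

lemma wt_single [simp]: "wt (Poly_Mapping.single c n) = n"
  by (cases "n = 0") (auto simp: wt_def)

lemma keys_sum_list: "Poly_Mapping.keys (sum_list I :: cvec) = (\<Union>i\<in>set I. Poly_Mapping.keys i)"
proof (induction I)
  case (Cons i I)
  have "Poly_Mapping.keys (i + sum_list I) = Poly_Mapping.keys i \<union> Poly_Mapping.keys (sum_list I)"
    by (auto simp: in_keys_iff lookup_add)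
  with Cons show ?case
    by simp
qed simp

text \<open>The content of a word, counting each color. On sorted words it is inverse to
  \<open>column_word\<close>, so columns can be treated as lists.\<close>

definition word_vec :: "color_word \<Rightarrow> cvec" where
  "word_vec w = sum_list (E w)"

definition column_word :: "cvec \<Rightarrow> color_word" where
  "column_word v = concat (map (\<lambda>c. replicate (Poly_Mapping.lookup v c) c)
                             (sorted_list_of_set (Poly_Mapping.keys v)))"

lemma cw_eq: "cw I = concat (map column_word I)"
  unfolding cw_def column_word_def ..

lemma word_vec_Nil [simp]: "word_vec [] = 0"
  by (simp add: word_vec_def E_def)

lemma word_vec_Cons: "word_vec (c # w) = Poly_Mapping.single c 1 + word_vec w"
  by (simp add: word_vec_def E_def)

lemma word_vec_append [simp]: "word_vec (v @ w) = word_vec v + word_vec w"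
  by (simp add: word_vec_def E_def)

lemma word_vec_concat: "word_vec (concat ws) = sum_list (map word_vec ws)"
  by (induction ws) auto

lemma lookup_word_vec: "Poly_Mapping.lookup (word_vec w) c = count (mset w) c"
  by (induction w) (auto simp: word_vec_Cons lookup_add lookup_single when_def)

lemma wt_word_vec [simp]: "wt (word_vec w) = length w"
  by (induction w) (auto simp: word_vec_Cons)

lemma keys_word_vec: "Poly_Mapping.keys (word_vec w) = set w"
  by (auto simp: in_keys_iff lookup_word_vec)

lemma E_eq: "E u = map word_vec (map (\<lambda>c. [c]) u)"
  by (simp add: E_def word_vec_Cons)

lemma mset_column_word: "count (mset (column_word v)) c = Poly_Mapping.lookup v c"
proof -
  have "count (mset (concat (map (\<lambda>c. replicate (f c) c) cs))) c = (if c \<in> set cs then f c else 0)"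
    if "distinct cs" for cs and f :: "nat \<Rightarrow> nat"
    using that by (induction cs) auto
  from this[of "sorted_list_of_set (Poly_Mapping.keys v)"] show ?thesis
    by (simp add: column_word_def in_keys_iff)
qed

lemma sorted_column_word: "sorted (column_word v)"
proof -
  have "sorted (concat (map (\<lambda>c. replicate (f c) c) cs))"
    if "sorted cs" for cs and f :: "nat \<Rightarrow> nat"
    using that by (induction cs) (auto simp: sorted_append)
  then show ?thesis
    by (simp add: column_word_def)
qed

lemma word_vec_column_word [simp]: "word_vec (column_word v) = v"
  by (rule poly_mapping_eqI) (simp add: lookup_word_vec mset_column_word)

lemma column_word_word_vec: "sorted w \<Longrightarrow> column_word (word_vec w) = w"
  by (metis lookup_word_vec mset_column_word multiset_eqI properties_for_sort sorted_column_word)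

lemma length_column_word [simp]: "length (column_word v) = wt v"
  by (metis word_vec_column_word wt_word_vec)

lemma set_column_word: "set (column_word v) = Poly_Mapping.keys v"
  by (metis word_vec_column_word keys_word_vec)

lemma map_word_vec_column_word: "map word_vec (map column_word I) = I"
  by (simp add: map_idI)

lemma cw_map_word_vec: "(\<And>w. w \<in> set ws \<Longrightarrow> sorted w) \<Longrightarrow> cw (map word_vec ws) = concat ws"
  by (simp add: cw_eq column_word_word_vec map_idI)

lemma length_cw: "length (cw I) = (\<Sum>i\<leftarrow>I. wt i)"
  by (simp add: cw_eq length_concat comp_def)

lemma cw_Cons: "cw (i # I) = column_word i @ cw I"
  by (simp add: cw_eq)

text \<open>The weights tell where to cut the coloring word, and each piece determines its column.
  Uniqueness of \<open>tilde\<close> and of \<open>peak_comp\<close> thus reduces to comparing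
  weights.\<close>

lemma eq_if_cw_eq_wt_eq:
  assumes "cw I = cw J" "map wt I = map wt J"
  shows "I = J"
  using assms
proof (induction I arbitrary: J)
  case (Cons i I)
  then obtain j J' where J: "J = j # J'"
    by (cases J) auto
  with Cons.prems have "column_word i = column_word j" "cw I = cw J'"
    by (auto simp: cw_Cons)
  with Cons J show ?case
    by simp (metis word_vec_column_word)
qed simp


section \<open>Coarsening\<close>

lemma concat_nonempty_eq_Nil: "[] \<notin> set xss \<Longrightarrow> concat xss = [] \<longleftrightarrow> xss = []"
  by (cases xss) auto

lemma coarsens_Nil_right [simp]: "J \<unlhd> [] \<longleftrightarrow> J = []"
  unfolding coarsens_def using concat_nonempty_eq_Nil by fastforce

lemma coarsens_Nil_left [simp]: "[] \<unlhd> I \<longleftrightarrow> I = []"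
  by (auto simp: coarsens_def)

lemma coarsens_singleton [simp]: "J \<unlhd> [i] \<longleftrightarrow> J = [i]"
proof
  assume "J \<unlhd> [i]"
  then obtain Bs where "concat Bs = [i]" "[] \<notin> set Bs" "J = map sum_list Bs"
    by (auto simp: coarsens_def)
  then show "J = [i]"
    using concat_nonempty_eq_Nil[of "tl Bs"]
    by (cases Bs) (auto simp: append_eq_Cons_conv simp del: concat_eq_Nil_conv)
next
  assume "J = [i]"
  then show "J \<unlhd> [i]"
    by (auto simp: coarsens_def intro!: exI[of _ "[[i]]"])
qed

lemma coarsens_refl: "I \<unlhd> I"
  unfolding coarsens_def by (rule exI[of _ "map (\<lambda>i. [i]) I"]) (auto simp: comp_def)

lemma coarsens_append: "J1 \<unlhd> I1 \<Longrightarrow> J2 \<unlhd> I2 \<Longrightarrow> J1 @ J2 \<unlhd> I1 @ I2"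
  unfolding coarsens_def by (metis Un_iff concat_append map_append set_append)

text \<open>A cut of the coarsening falls between two groups of columns, hence lifts to a cut of the
  finer composition.\<close>

lemma coarsens_append_left:
  assumes "J1 @ J2 \<unlhd> I"
  obtains k where "k \<le> length I" "J1 \<unlhd> take k I" "J2 \<unlhd> drop k I"
proof -
  from assms obtain Bs where Bs: "concat Bs = I" "[] \<notin> set Bs" "J1 @ J2 = map sum_list Bs"
    by (auto simp: coarsens_def)
  define n where "n = length J1"
  have J: "J1 = map sum_list (take n Bs)" "J2 = map sum_list (drop n Bs)"
    using Bs(3) by (metis append_eq_conv_conj n_def take_map, metis append_eq_conv_conj n_def drop_map)
  have I: "I = concat (take n Bs) @ concat (drop n Bs)"
    using Bs(1) by (metis append_take_drop_id concat_append)
  show ?thesis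
  proof
    show "length (concat (take n Bs)) \<le> length I"
      by (simp add: I)
    show "J1 \<unlhd> take (length (concat (take n Bs))) I" "J2 \<unlhd> drop (length (concat (take n Bs))) I"
      using Bs(2) unfolding coarsens_def J
      by (auto simp: I dest: in_set_takeD in_set_dropD)
  qed
qed

lemma coarsens_sum_list: "J \<unlhd> I \<Longrightarrow> sum_list J = sum_list I"
proof -
  have "sum_list (map sum_list Bs) = sum_list (concat Bs)" for Bs :: "cvec list list"
    by (induction Bs) auto
  then show "J \<unlhd> I \<Longrightarrow> sum_list J = sum_list I"
    by (auto simp: coarsens_def)
qed

text \<open>The first column either stays alone or is absorbed into the first column of a coarsening
  of the rest. This makes induction on the list possible.\<close>

lemma coarsens_Cons:
  assumes "I \<noteq> []"
  shows "{J. J \<unlhd> i # I} = (#) i ` {J. J \<unlhd> I} \<union> (\<lambda>J. (i + hd J) # tl J) ` {J. J \<unlhd> I}"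
proof (intro equalityI subsetI)
  fix J assume "J \<in> {J. J \<unlhd> i # I}"
  then obtain Bs where Bs: "concat Bs = i # I" "[] \<notin> set Bs" "J = map sum_list Bs"
    by (auto simp: coarsens_def)
  then obtain b B Bs' where eq: "Bs = (b # B) # Bs'"
    by (metis concat.simps(1) list.distinct(1) list.exhaust list.set_intros(1))
  show "J \<in> (#) i ` {J. J \<unlhd> I} \<union> (\<lambda>J. (i + hd J) # tl J) ` {J. J \<unlhd> I}"
  proof (cases "B = []")
    case True
    then have "map sum_list Bs' \<unlhd> I" "J = i # map sum_list Bs'"
      using Bs eq by (auto simp: coarsens_def)
    then show ?thesis by auto
  next
    case False
    then have "sum_list B # map sum_list Bs' \<unlhd> I" "J = (i + sum_list B) # map sum_list Bs'"
      using Bs eq by (auto simp: coarsens_def intro!: exI[of _ "B # Bs'"])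
    then show ?thesis
      by (intro UnI2 image_eqI[of _ _ "sum_list B # map sum_list Bs'"]) auto
  qed
next
  fix J assume "J \<in> (#) i ` {J. J \<unlhd> I} \<union> (\<lambda>J. (i + hd J) # tl J) ` {J. J \<unlhd> I}"
  then obtain J' where J': "J' \<unlhd> I" "J = i # J' \<or> J = (i + hd J') # tl J'"
    by auto
  then obtain Bs where Bs: "concat Bs = I" "[] \<notin> set Bs" "J' = map sum_list Bs"
    by (auto simp: coarsens_def)
  then obtain B Bs' where eq: "Bs = B # Bs'"
    using assms by (cases Bs) auto
  from J'(2) show "J \<in> {J. J \<unlhd> i # I}"
  proof
    assume "J = i # J'"
    then show ?thesis
      using coarsens_append[OF coarsens_refl[of "[i]"] J'(1)] by simp
  next
    assume "J = (i + hd J') # tl J'"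
    then show ?thesis
      using Bs eq by (auto simp: coarsens_def intro!: exI[of _ "(i # B) # Bs'"])
  qed
qed

lemma finite_coarsens [simp]: "finite {J. J \<unlhd> I}"
proof (induction I)
  case (Cons i I)
  then show ?case
    by (cases "I = []") (auto simp: coarsens_Cons)
qed simp

lemma coarsens_length: "J \<unlhd> I \<Longrightarrow> length J \<le> length I"
proof (induction I arbitrary: J)
  case (Cons i I)
  show ?case
  proof (cases "I = []")
    case False
    then have "J \<in> (#) i ` {J. J \<unlhd> I} \<union> (\<lambda>J. (i + hd J) # tl J) ` {J. J \<unlhd> I}"
      using Cons.prems coarsens_Cons[of I i] by blast
    then obtain J' where "J' \<unlhd> I" "J = i # J' \<or> J = (i + hd J') # tl J'"
      by auto
    with Cons.IH[of J'] show ?thesis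
      by auto
  qed (use Cons.prems in auto)
qed simp

text \<open>With \<open>coarsens_length\<close> this is the triangularity of the functions
  \<open>eta\<close> with respect to the number of columns.\<close>

lemma coarsens_same_length: "J \<unlhd> I \<Longrightarrow> length J = length I \<Longrightarrow> J = I"
proof (induction I arbitrary: J)
  case (Cons i I)
  show ?case
  proof (cases "I = []")
    case False
    then have "J \<in> (#) i ` {J. J \<unlhd> I} \<union> (\<lambda>J. (i + hd J) # tl J) ` {J. J \<unlhd> I}"
      using Cons.prems coarsens_Cons[of I i] by blast
    then obtain J' where J': "J' \<unlhd> I" "J = i # J' \<or> J = (i + hd J') # tl J'"
      by auto
    moreover have "J' \<noteq> []"
      using J' False by auto
    ultimately show ?thesis
      using Cons.IH[of J'] Cons.prems coarsens_length[of J' I] by (auto simp: Suc_le_eq)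
  qed (use Cons.prems in auto)
qed simp

text \<open>Entries are natural numbers, so nothing cancels: a group with sum zero would start with
  a zero column.\<close>

lemma coarsens_nonzero:
  assumes "J \<unlhd> I" "0 \<notin> set I"
  shows "0 \<notin> set J"
proof
  assume "0 \<in> set J"
  with assms(1) obtain B where B: "set B \<subseteq> set I" "B \<noteq> []" "sum_list B = 0"
    unfolding coarsens_def by fastforce
  from B(2) have "wt (hd B) \<le> wt (sum_list B)"
    by (cases B) auto
  then have "hd B = 0"
    using B(3) by simp
  moreover have "hd B \<in> set I"
    using B(1,2) hd_in_set by blast
  ultimately show False
    using assms(2) by simp
qed

lemma coarsens_vcomps:
  assumes "J \<unlhd> I" "I \<in> vcomps l"
  shows "J \<in> vcomps l"
proof -
  from assms(2) have "0 \<notin> set I"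
    by (auto simp: vcomps_def)
  then have "0 \<notin> set J"
    using coarsens_nonzero assms(1) by blast
  moreover have "Poly_Mapping.keys j \<subseteq> {..<l}" if "j \<in> set J" for j
  proof -
    from that assms(1) obtain B where B: "set B \<subseteq> set I" "j = sum_list B"
      unfolding coarsens_def by fastforce
    with assms(2) show ?thesis
      unfolding B(2) keys_sum_list vcomps_def by blast
  qed
  ultimately show ?thesis
    unfolding vcomps_def by blast
qed

text \<open>Adding one column on the left replaces each coarsening by two, of lengths differing by one.\<close>

lemma sum_coarsens:
  assumes "0 \<notin> set I" "I \<noteq> []"
  shows "(\<Sum>J | J \<unlhd> I. (- 2) ^ length J) = 2 * (- 1 :: rat) ^ length I"
  using assms
proof (induction I)
  case (Cons i I)
  show ?case
  proof (cases "I = []")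
    case False
    let ?C = "{J. J \<unlhd> I}" and ?f = "\<lambda>J. (i + hd J) # tl J"
    have ne: "J \<noteq> []" if "J \<unlhd> I" for J
      using that False by auto
    have hd: "hd J \<noteq> 0" if "J \<unlhd> I" for J
      using coarsens_nonzero[OF that] Cons.prems ne[OF that] hd_in_set by fastforce
    \<comment> \<open>A merged first column differs from \<open>i\<close> by the nonzero vector
      \<open>hd J\<close>. Keeping \<open>i\<close> apart gives the factor -2, merging it gives 1,
      so together the sum changes sign.\<close>
    have "(#) i ` ?C \<inter> ?f ` ?C = {}"
      using hd by auto
    moreover have inj: "inj_on ?f ?C"
      using ne by (intro inj_onI) (metis (no_types, lifting) add_left_cancel list.collapse list.inject mem_Collect_eq)
    ultimately have "(\<Sum>J | J \<unlhd> i # I. (- 2 :: rat) ^ length J) =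
        (\<Sum>J\<in>?C. (- 2) ^ length (i # J)) + (\<Sum>J\<in>?C. (- 2) ^ length (?f J))"
      by (simp add: coarsens_Cons[OF False] sum.union_disjoint sum.reindex)
    also have "(\<Sum>J\<in>?C. (- 2 :: rat) ^ length (?f J)) = (\<Sum>J\<in>?C. (- 2) ^ length J)"
      using ne by (intro sum.cong) auto
    also have "(\<Sum>J\<in>?C. (- 2 :: rat) ^ length (i # J)) = - 2 * (\<Sum>J\<in>?C. (- 2) ^ length J)"
      by (simp add: sum_distrib_left)
    finally show ?thesis
      using Cons False by simp
  qed simp
qed simp

lemma coarsens_total: "[j] \<unlhd> I \<longleftrightarrow> I \<noteq> [] \<and> j = sum_list I"
proof
  assume "[j] \<unlhd> I"
  then show "I \<noteq> [] \<and> j = sum_list I"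
    using coarsens_sum_list[of "[j]" I] by auto
next
  assume "I \<noteq> [] \<and> j = sum_list I"
  then show "[j] \<unlhd> I"
    by (auto simp: coarsens_def intro!: exI[of _ "[I]"])
qed

lemma coarsens_trans: "J \<unlhd> K \<Longrightarrow> K \<unlhd> I \<Longrightarrow> J \<unlhd> I"
proof (induction J arbitrary: K I)
  case (Cons j J)
  from Cons.prems(1) obtain k where k: "[j] \<unlhd> take k K" "J \<unlhd> drop k K"
    using coarsens_append_left[of "[j]" J K] by auto
  from Cons.prems(2) obtain m where m: "take k K \<unlhd> take m I" "drop k K \<unlhd> drop m I"
    using coarsens_append_left[of "take k K" "drop k K" I] by auto
  have "[j] \<unlhd> take m I"
    using k(1) m(1) coarsens_sum_list[OF m(1)] unfolding coarsens_total by force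
  moreover have "J \<unlhd> drop m I"
    using Cons.IH k(2) m(2) by blast
  ultimately show ?case
    using coarsens_append by fastforce
qed auto

section \<open>Cut positions and peaks of a composition\<close>

lemma D_iff: "d \<in> D J \<longleftrightarrow> (\<exists>A B. J = A @ B \<and> A \<noteq> [] \<and> B \<noteq> [] \<and> d = wt (sum_list A))"
proof
  assume "d \<in> D J"
  then obtain r where "d = partial_wt J r" "1 \<le> r" "r < length J"
    by (auto simp: D_def)
  then show "\<exists>A B. J = A @ B \<and> A \<noteq> [] \<and> B \<noteq> [] \<and> d = wt (sum_list A)"
    by (intro exI[of _ "take r J"] exI[of _ "drop r J"])
      (auto simp: partial_wt_def wt_sum_list)
next
  assume "\<exists>A B. J = A @ B \<and> A \<noteq> [] \<and> B \<noteq> [] \<and> d = wt (sum_list A)"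
  then obtain A B where "J = A @ B" "A \<noteq> []" "B \<noteq> []" "d = wt (sum_list A)"
    by blast
  then show "d \<in> D J"
    unfolding D_def
    by (auto intro!: exI[of _ "length A"] simp: partial_wt_def wt_sum_list Suc_le_eq)
qed

lemma coarsens_D_subset:
  assumes "J \<unlhd> I"
  shows "D J \<subseteq> D I"
proof
  fix d assume "d \<in> D J"
  then obtain A B where AB: "J = A @ B" "A \<noteq> []" "B \<noteq> []" "d = wt (sum_list A)"
    by (auto simp: D_iff)
  with assms obtain k where k: "A \<unlhd> take k I" "B \<unlhd> drop k I"
    using coarsens_append_left by blast
  then have "take k I \<noteq> []" "drop k I \<noteq> []"
    using AB by (auto simp del: take_eq_Nil drop_eq_Nil)
  then show "d \<in> D I"
    unfolding D_iff using AB(4) coarsens_sum_list[OF k(1)] by (metis append_take_drop_id)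
qed

lemma D_Cons: "D (i # I) = (if I = [] then {} else insert (wt i) ((+) (wt i) ` D I))"
proof -
  have "d \<in> D (i # I) \<longleftrightarrow> I \<noteq> [] \<and> (d = wt i \<or> d \<in> (+) (wt i) ` D I)" for d
  proof
    assume "d \<in> D (i # I)"
    then obtain A B where AB: "i # I = A @ B" "A \<noteq> []" "B \<noteq> []" "d = wt (sum_list A)"
      unfolding D_iff by blast
    then obtain A' where A': "A = i # A'" "I = A' @ B"
      by (cases A) auto
    have "wt (sum_list A') \<in> D I" if "A' \<noteq> []"
      unfolding D_iff using A' AB(3) that by blast
    with AB A' show "I \<noteq> [] \<and> (d = wt i \<or> d \<in> (+) (wt i) ` D I)"
      by (cases "A' = []") auto
  next
    assume d: "I \<noteq> [] \<and> (d = wt i \<or> d \<in> (+) (wt i) ` D I)"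
    then consider "I \<noteq> []" "d = wt i" | A B where "I = A @ B" "B \<noteq> []" "d = wt i + wt (sum_list A)"
      unfolding image_iff Bex_def D_iff by blast
    then show "d \<in> D (i # I)"
    proof cases
      case 1
      then show ?thesis
        unfolding D_iff by (intro exI[of _ "[i]"] exI[of _ I]) simp
    next
      case 2
      then show ?thesis
        unfolding D_iff by (intro exI[of _ "i # A"] exI[of _ B]) simp
    qed
  qed
  then show ?thesis
    by auto
qed

lemma D_Nil [simp]: "D [] = {}"
  by (simp add: D_def)

lemma Pk_Nil [simp]: "Pk [] = {}"
  by (simp add: Pk_def)

lemma Pk_Cons:
  "Pk (i # I) = (if I \<noteq> [] \<and> wt i \<ge> 2 then {wt i} else {}) \<union> (+) (wt i) ` Pk I"
proof (intro set_eqI iffI)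
  fix s assume "s \<in> Pk (i # I)"
  then obtain r where r: "s = partial_wt (i # I) r" "1 \<le> r" "r < length (i # I)"
      "wt ((i # I) ! (r - 1)) \<ge> 2"
    by (auto simp: Pk_def)
  then obtain q where "r = Suc q"
    by (cases r) auto
  with r show "s \<in> (if I \<noteq> [] \<and> wt i \<ge> 2 then {wt i} else {}) \<union> (+) (wt i) ` Pk I"
  proof (cases q)
    case (Suc p)
    have "partial_wt I q \<in> Pk I"
      unfolding Pk_def using r \<open>r = Suc q\<close> Suc by auto
    moreover have "s = wt i + partial_wt I q"
      using r \<open>r = Suc q\<close> by (simp add: partial_wt_def)
    ultimately show ?thesis
      by blast
  qed (auto simp: partial_wt_def)
next
  fix s assume "s \<in> (if I \<noteq> [] \<and> wt i \<ge> 2 then {wt i} else {}) \<union> (+) (wt i) ` Pk I"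
  then consider "I \<noteq> []" "wt i \<ge> 2" "s = wt i" | r where "s = wt i + partial_wt I r" "1 \<le> r"
      "r < length I" "wt (I ! (r - 1)) \<ge> 2"
    by (auto simp: Pk_def split: if_splits)
  then show "s \<in> Pk (i # I)"
  proof cases
    case 1
    then show ?thesis
      unfolding Pk_def by (auto intro!: exI[of _ 1] simp: partial_wt_def)
  next
    case 2
    then show ?thesis
      unfolding Pk_def
      by (auto intro!: exI[of _ "Suc r"] simp: partial_wt_def nth_Cons split: nat.split)
  qed
qed

section \<open>Coarsenings of a fixed word\<close>

lemma E_Nil [simp]: "E [] = []"
  by (simp add: E_def)

lemma E_append: "E (v @ w) = E v @ E w"
  by (simp add: E_def)

lemma coarsens_E_intro:
  assumes "[] \<notin> set vs"
  shows "map word_vec vs \<unlhd> E (concat vs)"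
  using assms
proof (induction vs)
  case (Cons v vs)
  have "[word_vec v] \<unlhd> E v"
    using Cons.prems unfolding coarsens_total by (auto simp: word_vec_def E_def)
  with Cons show ?case
    using coarsens_append[of "[word_vec v]" "E v"] by (simp add: E_append)
qed simp

lemma coarsens_E_elim:
  assumes "J \<unlhd> E u"
  obtains vs where "J = map word_vec vs" "concat vs = u" "[] \<notin> set vs"
proof -
  have "\<exists>vs. J = map word_vec vs \<and> concat vs = u \<and> [] \<notin> set vs"
    using assms
  proof (induction J arbitrary: u)
    case Nil
    then show ?case
      by (auto simp: E_def)
  next
    case (Cons j J)
    from Cons.prems obtain k where k: "[j] \<unlhd> take k (E u)" "J \<unlhd> drop k (E u)"
      using coarsens_append_left[of "[j]" J "E u"] by auto
    have "j = word_vec (take k u)" "take k u \<noteq> []"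
      using k(1) unfolding coarsens_total by (auto simp: word_vec_def E_def take_map)
    moreover from k(2) obtain vs where "J = map word_vec vs" "concat vs = drop k u" "[] \<notin> set vs"
      using Cons.IH[of "drop k u"] by (auto simp: E_def drop_map)
    ultimately show ?case
      by (intro exI[of _ "take k u # vs"]) auto
  qed
  with that show ?thesis
    by blast
qed

text \<open>Converse of \<open>coarsens_D_subset\<close>: since both lists cut the same word, their
  cut positions alone decide which is coarser.\<close>

lemma coarsens_if_D_subset:
  assumes "concat vs = concat ws" "[] \<notin> set vs" "[] \<notin> set ws"
    and "D (map word_vec vs) \<subseteq> D (map word_vec ws)"
  shows "map word_vec vs \<unlhd> map word_vec ws"
  using assms
proof (induction vs arbitrary: ws)
  case Nil
  then show ?case
    by (metis coarsens_refl concat.simps(1) concat_nonempty_eq_Nil)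
next
  case (Cons v vs)
  show ?case
  proof (cases "vs = []")
    case True
    with Cons.prems have "ws \<noteq> []" "v = concat ws"
      by auto
    with True show ?thesis
      by (simp add: coarsens_total word_vec_concat)
  next
    case False
    \<comment> \<open>The end of \<open>v\<close> is also a cut of the finer list, so the first
      column is made up of an initial part \<open>ys\<close> of \<open>ws\<close>.\<close>
    have "length v \<in> D (map word_vec ws)"
      using Cons.prems(4) False by (auto simp: D_Cons)
    then obtain A B where "map word_vec ws = A @ B" "A \<noteq> []" "B \<noteq> []" "length v = wt (sum_list A)"
      by (auto simp: D_iff)
    then obtain ys zs where yz: "ws = ys @ zs" "A = map word_vec ys" "B = map word_vec zs"
        "ys \<noteq> []" "zs \<noteq> []"
      by (auto simp: map_eq_append_conv)
    have lv: "length v = length (concat ys)"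
      using \<open>length v = _\<close> yz by (simp flip: word_vec_concat)
    with Cons.prems(1) yz have v: "v = concat ys" "concat vs = concat zs"
      by auto
    have "D (map word_vec vs) \<subseteq> D (map word_vec zs)"
    proof
      fix d assume d: "d \<in> D (map word_vec vs)"
      \<comment> \<open>Positivity puts the cut \<open>length v + d\<close> strictly behind the end
        of \<open>ys\<close>, so that the piece \<open>t\<close> in between is nonempty.\<close>
      then have "d > 0"
      proof -
        from d obtain A B where "map word_vec vs = A @ B" "A \<noteq> []" "d = wt (sum_list A)"
          unfolding D_iff by blast
        then obtain xs ys where "vs = xs @ ys" "A = map word_vec xs"
          unfolding map_eq_append_conv by blast
        with \<open>A \<noteq> []\<close> \<open>d = wt (sum_list A)\<close> have "xs \<noteq> []" "d = length (concat xs)"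
          by (auto simp flip: word_vec_concat)
        with Cons.prems(2) \<open>vs = xs @ ys\<close> show ?thesis
          using concat_nonempty_eq_Nil[of xs] by (auto simp del: concat_eq_Nil_conv)
      qed
      have "length v + d \<in> D (map word_vec ws)"
        using Cons.prems(4) False d by (auto simp: D_Cons)
      then obtain A' B' where "map word_vec ws = A' @ B'" "B' \<noteq> []"
          "length v + d = wt (sum_list A')"
        by (auto simp: D_iff)
      then obtain ys' zs' where "ws = ys' @ zs'" "A' = map word_vec ys'" "B' = map word_vec zs'"
        unfolding map_eq_append_conv by blast
      with \<open>B' \<noteq> []\<close> \<open>length v + d = _\<close> have yz': "ws = ys' @ zs'" "zs' \<noteq> []"
          "length v + d = length (concat ys')"
        by (auto simp flip: word_vec_concat)
      have "ys @ zs = ys' @ zs'"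
        using yz(1) yz'(1) by simp
      then obtain t where t: "(ys = ys' @ t \<and> t @ zs = zs') \<or> (ys @ t = ys' \<and> zs = t @ zs')"
        by (auto simp: append_eq_append_conv2)
      then have "ys' = ys @ t" "zs = t @ zs'" "d = length (concat t)"
        using yz'(3) lv \<open>d > 0\<close> by auto
      with yz'(2) \<open>d > 0\<close> show "d \<in> D (map word_vec zs)"
        unfolding D_iff
        by (intro exI[of _ "map word_vec t"] exI[of _ "map word_vec zs'"])
          (auto simp flip: word_vec_concat)
    qed
    then have "map word_vec vs \<unlhd> map word_vec zs"
      using Cons.prems yz(1) v(2) by (intro Cons.IH) auto
    moreover have "[word_vec v] \<unlhd> map word_vec ys"
      using yz(4) by (simp add: coarsens_total v(1) word_vec_concat)
    ultimately show ?thesis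
      using coarsens_append yz(1) by fastforce
  qed
qed

lemma coarsens_map_word_vec_iff:
  assumes "[] \<notin> set ws"
  shows "J \<unlhd> map word_vec ws \<longleftrightarrow> J \<unlhd> E (concat ws) \<and> D J \<subseteq> D (map word_vec ws)"
proof
  assume "J \<unlhd> map word_vec ws"
  then show "J \<unlhd> E (concat ws) \<and> D J \<subseteq> D (map word_vec ws)"
    using coarsens_trans coarsens_E_intro[OF assms] coarsens_D_subset by blast
next
  assume J: "J \<unlhd> E (concat ws) \<and> D J \<subseteq> D (map word_vec ws)"
  then obtain vs where "J = map word_vec vs" "concat vs = concat ws" "[] \<notin> set vs"
    using coarsens_E_elim by metis
  with J assms show "J \<unlhd> map word_vec ws"
    using coarsens_if_D_subset by auto
qed


section \<open>Odd compositions and peaks\<close>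

text \<open>The construction \<open>I \<mapsto> I\<close>-tilde on the level of the words of the columns.\<close>

fun split_pairs :: "color_word list \<Rightarrow> color_word list" where
  "split_pairs [] = []"
| "split_pairs ([] # ws) = split_pairs ws"
| "split_pairs ([a] # ws) = [a] # split_pairs ws"
| "split_pairs ((a # b # w) # ws) = [a, b] # split_pairs (w # ws)"

abbreviation odd_words :: "color_word list \<Rightarrow> bool" where
  "odd_words ws \<equiv> \<forall>w\<in>set ws. odd (length w)"

abbreviation peaks :: "color_word list \<Rightarrow> nat set" where
  "peaks ws \<equiv> Pk (map word_vec (split_pairs ws))"

lemma concat_split_pairs: "concat (split_pairs ws) = concat ws"
  by (induction ws rule: split_pairs.induct) auto

lemma sorted_split_pairs:
  "\<forall>w\<in>set ws. sorted w \<Longrightarrow> w \<in> set (split_pairs ws) \<Longrightarrow> sorted w"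
  by (induction ws rule: split_pairs.induct) auto

lemma split_pairs_nonempty: "odd_words ws \<Longrightarrow> ws \<noteq> [] \<Longrightarrow> split_pairs ws \<noteq> []"
  by (induction ws rule: split_pairs.induct) auto

lemma length_last_split_pairs:
  "odd_words ws \<Longrightarrow> ws \<noteq> [] \<Longrightarrow> length (last (split_pairs ws)) = 1"
proof (induction ws rule: split_pairs.induct)
  case (3 a ws)
  then show ?case
    using split_pairs_nonempty[of ws] by (cases "ws = []") auto
next
  case (4 a b w ws)
  then show ?case
    using split_pairs_nonempty[of "w # ws"] by auto
qed auto

lemma split_pairs_Cons: "split_pairs (w # ws) = split_pairs [w] @ split_pairs ws"
  by (induction w rule: induct_list012) auto

lemma split_pairs_eq_concat: "split_pairs ws = concat (map (\<lambda>w. split_pairs [w]) ws)"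
proof (induction ws)
  case (Cons w ws)
  then show ?case
    by (subst split_pairs_Cons) simp
qed simp

lemma length_butlast_split_pairs:
  "odd (length w) \<Longrightarrow> v \<in> set (butlast (split_pairs [w])) \<Longrightarrow> length v = 2"
proof (induction w rule: induct_list012)
  case (3 a b w)
  then show ?case
    by (auto split: if_splits)
qed auto

lemma peaks_singleton: "peaks ([a] # ws) = Suc ` peaks ws"
  by (auto simp: Pk_Cons)

text \<open>Oddness guarantees that a column follows the pair \<open>[a, b]\<close>; were it the
  last one, \<open>Pk\<close> would not count it.\<close>

lemma peaks_pair:
  "odd_words ((a # b # w) # ws) \<Longrightarrow>
   peaks ((a # b # w) # ws) = insert 2 ((+) 2 ` peaks (w # ws))"
  using split_pairs_nonempty[of "w # ws"] by (auto simp: Pk_Cons)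

text \<open>Peaks within one column are two apart. The single letter closing each column separates
  the peaks of different columns by at least three and keeps the last peak below the length.\<close>

lemma peak_subset_peaks: "odd_words ws \<Longrightarrow> peak_subset (length (concat ws)) (peaks ws)"
proof (induction ws rule: split_pairs.induct)
  case (3 a ws)
  then show ?case
    by (fastforce simp: peak_subset_def peaks_singleton simp del: split_pairs.simps)
next
  case (4 a b w ws)
  then have IH: "peak_subset (length (concat (w # ws))) (peaks (w # ws))"
    by simp
  have ne: "w \<noteq> []"
    using 4 by auto
  define X where "X = peaks (w # ws)"
  define n where "n = length (concat (w # ws))"
  have "X \<subseteq> {2..n - 1}" "\<forall>s\<in>X. s - 1 \<notin> X"
    using IH unfolding peak_subset_def X_def n_def by blast+
  \<comment> \<open>A further letter is required so that the new peak 2 is at most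
    \<open>2 + n - 1\<close>.\<close>
  moreover have "n > 0"
    using ne by (simp add: n_def)
  ultimately have "peak_subset (2 + n) (insert 2 ((+) 2 ` X))"
    unfolding peak_subset_def by fastforce
  then show ?case
    unfolding peaks_pair[OF 4(2)] X_def n_def by simp
qed (auto simp: peak_subset_def)

text \<open>
  The peaks \<open>s\<close> of \<open>I\<close>-tilde lie at even distances \<open>2, 4, \<dots>\<close> from the beginning of each column of
  \<open>I\<close>, so that the pairs \<open>s - 1, s\<close> fill exactly the gaps left by \<open>D I\<close>.
\<close>

lemma not_in_D_iff_peaks:
  assumes "odd_words ws" "1 \<le> d" "d < length (concat ws)"
  shows "d \<notin> D (map word_vec ws) \<longleftrightarrow> d \<in> peaks ws \<or> Suc d \<in> peaks ws"
  using assms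
proof (induction ws arbitrary: d rule: split_pairs.induct)
  case (3 a ws)
  \<comment> \<open>This settles \<open>d = 1\<close>, the cut right after \<open>a\<close>: after
    the shift, 1 or 2 would be a peak only if 0 or 1 were one of the rest.\<close>
  have "0 \<notin> peaks ws" "1 \<notin> peaks ws"
    using peak_subset_peaks[of ws] 3(2) by (auto simp: peak_subset_def)
  moreover obtain e where e: "d = Suc e"
    using 3(3) by (cases d) auto
  moreover have "ws \<noteq> []"
    using 3(3,4) by auto
  moreover have "e \<notin> D (map word_vec ws) \<longleftrightarrow> e \<in> peaks ws \<or> Suc e \<in> peaks ws" if "e \<noteq> 0"
    using 3 e that by auto
  moreover have "0 \<notin> D (map word_vec ws)"
    using 3(2) by (cases ws) (auto simp: D_Cons)
  ultimately show ?case
    unfolding peaks_singleton by (cases "e = 0") (auto simp: D_Cons inj_image_mem_iff)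
next
  case (4 a b w ws)
  have odd: "odd_words (w # ws)"
    using 4(2) by auto
  have pk: "0 \<notin> peaks (w # ws)" "1 \<notin> peaks (w # ws)"
    using peak_subset_peaks[OF odd] by (auto simp: peak_subset_def simp del: split_pairs.simps)
  have D: "D (map word_vec ((a # b # w) # ws)) = (+) 2 ` D (map word_vec (w # ws))"
    by (auto simp: D_Cons)
  have D0: "0 \<notin> D (map word_vec (w # ws))"
    using odd by (auto simp: D_Cons)
  \<comment> \<open>The new peak 2 accounts for the positions 1 and 2, neither of which is a cut;
    all later positions are shifted by 2.\<close>
  consider "d = 1" | "d = 2" | e where "d = 2 + e" "e \<ge> 1"
    using 4(3) by (metis One_nat_def Suc_1 add_2_eq_Suc less_2_cases_iff less_one linorder_not_le nat_le_iff_add not_less_eq_eq)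
  then show ?case
  proof cases
    case 1
    then show ?thesis
      unfolding D peaks_pair[OF 4(2)] by auto
  next
    case 2
    then show ?thesis
      unfolding D peaks_pair[OF 4(2)] using D0 by auto
  next
    case (3 e)
    then have "e \<notin> D (map word_vec (w # ws)) \<longleftrightarrow> e \<in> peaks (w # ws) \<or> Suc e \<in> peaks (w # ws)"
      using 4(4) odd by (intro 4(1)) auto
    with 3 show ?thesis
      unfolding D peaks_pair[OF 4(2)] by (auto simp del: split_pairs.simps)
  qed
qed auto

text \<open>A cut \<open>d\<close> is forbidden just when \<open>d\<close> or \<open>Suc d\<close>
  is a peak. Read from the side of the peaks, the absence of forbidden cuts is a disjointness
  condition.\<close>

lemma coarsens_odd_words_iff:
  assumes "odd_words ws"
  shows "J \<unlhd> map word_vec ws \<longleftrightarrow>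
    J \<unlhd> E (concat ws) \<and> peaks ws \<inter> (D J \<union> Suc ` D J) = {}"
proof -
  have ne: "[] \<notin> set ws"
    using assms by auto
  have "D J \<subseteq> D (map word_vec ws) \<longleftrightarrow> peaks ws \<inter> (D J \<union> Suc ` D J) = {}"
    if "J \<unlhd> E (concat ws)"
  proof -
    \<comment> \<open>\<open>not_in_D_iff_peaks\<close> speaks of inner positions of the word, and
      every cut of a coarsening of \<open>E\<close> is one.\<close>
    have "1 \<le> d \<and> d < length (concat ws)" if d: "d \<in> D J" for d
    proof -
      have "d \<in> D (E (concat ws))"
        using d \<open>J \<unlhd> E (concat ws)\<close> coarsens_D_subset by blast
      then obtain A B where AB: "map word_vec (map (\<lambda>c. [c]) (concat ws)) = A @ B" "A \<noteq> []" "B \<noteq> []"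
          "d = wt (sum_list A)"
        unfolding D_iff E_eq by blast
      then obtain x y where xy: "concat ws = x @ y" "A = E x" "B = E y"
        unfolding map_eq_append_conv E_eq by blast
      then have "d = length x"
        using AB(4) by (simp flip: word_vec_def)
      with AB xy show ?thesis
        by (cases x; cases y) auto
    qed
    then have "d \<in> D (map word_vec ws) \<longleftrightarrow> d \<notin> peaks ws \<and> Suc d \<notin> peaks ws" if "d \<in> D J" for d
      using not_in_D_iff_peaks[OF assms] that by blast
    then show ?thesis
      by auto
  qed
  then show ?thesis
    using coarsens_map_word_vec_iff[OF ne] by blast
qed

text \<open>Walk through the pairs: one whose peak is kept is glued to the column behind it, one
  whose peak is dropped becomes two columns of one letter each.\<close>

lemma ex_peaks_eq_subset:
  assumes "odd_words ws" "\<forall>w\<in>set ws. sorted w" "T \<subseteq> peaks ws"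
  obtains vs where "odd_words vs" "\<forall>w\<in>set vs. sorted w" "concat vs = concat ws" "peaks vs = T"
proof -
  have "\<exists>vs. odd_words vs \<and> (\<forall>w\<in>set vs. sorted w) \<and> concat vs = concat ws \<and> peaks vs = T"
    using assms
  proof (induction ws arbitrary: T rule: split_pairs.induct)
    case 1
    then show ?case
      by (intro exI[of _ "[]"]) auto
  next
    case (3 a ws)
    from 3(4) obtain T' where T': "T' \<subseteq> peaks ws" "T = Suc ` T'"
      unfolding peaks_singleton by (auto simp: subset_image_iff)
    moreover have "odd_words ws" "\<forall>w\<in>set ws. sorted w"
      using 3(2,3) by auto
    ultimately obtain vs where "odd_words vs" "\<forall>w\<in>set vs. sorted w" "concat vs = concat ws"
        "peaks vs = T'"
      using 3(1) by blast
    with T' show ?case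
      by (intro exI[of _ "[a] # vs"]) (auto simp: peaks_singleton simp del: split_pairs.simps)
  next
    case (4 a b w ws)
    have "T - {2} \<subseteq> (+) 2 ` peaks (w # ws)"
      using 4(4) unfolding peaks_pair[OF 4(2)] by auto
    then obtain T' where T': "T' \<subseteq> peaks (w # ws)" "T - {2} = (+) 2 ` T'"
      by (auto simp: subset_image_iff)
    moreover have "odd_words (w # ws)" "\<forall>w\<in>set (w # ws). sorted w"
      using 4(2,3) by auto
    ultimately obtain vs where vs: "odd_words vs" "\<forall>w\<in>set vs. sorted w"
        "concat vs = concat (w # ws)" "peaks vs = T'"
      using 4(1) by blast
    have "w \<noteq> []"
      using 4(2) by auto
    then obtain v vs' where v: "vs = v # vs'"
      using vs(3) by (cases vs) auto
    have "v \<noteq> []"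
      using vs(1) v by auto
    show ?case
    proof (cases "2 \<in> T")
      case True
      have odd: "odd_words ((a # b # v) # vs')"
        using vs(1) v by auto
      \<comment> \<open>Recutting preserves the word, so \<open>v\<close> still begins with the
        letter that followed \<open>b\<close>, and gluing keeps the column sorted.\<close>
      have "hd v = hd w"
        using vs(3) v \<open>v \<noteq> []\<close> \<open>w \<noteq> []\<close> by (metis concat.simps(2) hd_append2)
      then have "b \<le> hd v" "a \<le> b"
        using 4(3) \<open>w \<noteq> []\<close> by auto
      then have "sorted (a # b # v)"
        using vs(2) v \<open>v \<noteq> []\<close> by (cases v) auto
      moreover have "peaks ((a # b # v) # vs') = T"
        unfolding peaks_pair[OF odd] using vs(4) v T'(2) True by auto
      ultimately show ?thesis
        using odd vs v by (intro exI[of _ "(a # b # v) # vs'"]) (auto simp del: split_pairs.simps)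
    next
      case False
      have "peaks ([a] # [b] # vs) = T"
        using vs(4) T'(2) False unfolding peaks_singleton by (simp add: image_image)
      with vs show ?thesis
        by (intro exI[of _ "[a] # [b] # vs"]) (auto simp del: split_pairs.simps)
    qed
  qed auto
  with that show ?thesis
    by blast
qed

section \<open>Uniqueness of the tilde, of the odd blocks and of the peak composition\<close>

lemma map_wt_tilde_block:
  assumes "B \<noteq> []" "\<forall>b\<in>set (butlast B). wt b = 2" "wt (last B) = 1"
  shows "map wt B = replicate (wt (sum_list B) div 2) 2 @ [1]"
proof -
  obtain C b where B: "B = C @ [b]"
    using assms(1) by (metis append_butlast_last_id)
  have C: "map wt C = replicate (length C) 2"
    using assms B by (intro replicate_eqI) auto
  then have "wt (sum_list C) = 2 * length C"
    by (simp add: wt_sum_list sum_list_replicate)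
  with assms B C show ?thesis
    by simp
qed

text \<open>The weight of a column forces the number of twos in its block, so only the shared
  coloring word is needed besides to determine \<open>K\<close>.\<close>

lemma is_tilde_wt:
  assumes "is_tilde I K"
  shows "map wt K = concat (map (\<lambda>i. replicate (wt i div 2) 2 @ [1]) I)"
proof -
  from assms obtain Bs where K: "K = concat Bs" and
    all: "list_all2 (\<lambda>i B. sum_list B = i \<and> B \<noteq> [] \<and>
                     (\<forall>b\<in>set (butlast B). wt b = 2) \<and> wt (last B) = 1) I Bs"
    by (auto simp: is_tilde_def)
  from all have "map wt (concat Bs) = concat (map (\<lambda>i. replicate (wt i div 2) 2 @ [1]) I)"
    by (induction rule: list_all2_induct) (auto simp: map_wt_tilde_block)
  with K show ?thesis
    by simp
qed

lemma tilde_eqI: "is_tilde I K \<Longrightarrow> tilde I = K"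
  unfolding tilde_def
  by (rule the_equality) (auto intro!: eq_if_cw_eq_wt_eq simp: is_tilde_wt, simp_all add: is_tilde_def)

text \<open>An odd column ends its block, so of two blocks starting at the same place neither can
  properly extend the other.\<close>

lemma odd_blocks_unique: "odd_blocks I Bs \<Longrightarrow> odd_blocks I Cs \<Longrightarrow> Bs = Cs"
proof (induction Bs arbitrary: I Cs)
  case Nil
  then show ?case
    by (cases Cs) (auto simp: odd_blocks_def)
next
  case (Cons B Bs)
  then obtain C Cs' where Cs: "Cs = C # Cs'"
    by (cases Cs) (auto simp: odd_blocks_def)
  have no_ext: False if "A @ t = A'" "t \<noteq> []" "A \<noteq> []" "odd (wt (last A))"
    "\<forall>i\<in>set (butlast A'). even (wt i)" for A t A' :: vcomp
    using that by (auto simp: butlast_append)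
  have eq: "B @ concat Bs = C @ concat Cs'"
    using Cons.prems Cs by (auto simp: odd_blocks_def)
  have BC: "B \<noteq> []" "odd (wt (last B))" "\<forall>i\<in>set (butlast B). even (wt i)"
      "C \<noteq> []" "odd (wt (last C))" "\<forall>i\<in>set (butlast C). even (wt i)"
    using Cons.prems Cs by (auto simp: odd_blocks_def)
  from eq obtain t where "(B = C @ t) \<or> (B @ t = C)"
    by (auto simp: append_eq_append_conv2)
  then have "B = C"
    using no_ext[of B t C] no_ext[of C t B] BC by auto
  moreover have "Bs = Cs'"
    using Cons.prems Cs eq \<open>B = C\<close> by (intro Cons.IH[of "concat Bs"]) (auto simp: odd_blocks_def)
  ultimately show ?case
    using Cs by simp
qed

lemma odd_comp_eqI: "odd_blocks I Bs \<Longrightarrow> odd_comp I = map sum_list Bs"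
  unfolding odd_comp_def using odd_blocks_unique by (metis the_equality)

lemma ex_odd_blocks:
  assumes "I \<noteq> [] \<longrightarrow> odd (wt (last I))"
  obtains Bs where "odd_blocks I Bs"
proof -
  have "\<exists>Bs. odd_blocks I Bs"
    using assms
  proof (induction I)
    case Nil
    then show ?case
      by (intro exI[of _ "[]"]) (simp add: odd_blocks_def)
  next
    case (Cons i I)
    then obtain Bs where Bs: "odd_blocks I Bs"
      by (auto split: if_splits)
    show ?case
    proof (cases "odd (wt i)")
      case True
      with Bs show ?thesis
        by (intro exI[of _ "[i] # Bs"]) (auto simp: odd_blocks_def)
    next
      case False
      with Cons.prems have "I \<noteq> []"
        by auto
      with Bs obtain B Bs' where "Bs = B # Bs'"
        by (cases Bs) (auto simp: odd_blocks_def)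
      with False Bs show ?thesis
        by (intro exI[of _ "(i # B) # Bs'"]) (auto simp: odd_blocks_def)
    qed
  qed
  with that show ?thesis
    by blast
qed

lemma Pk_ge_2: "s \<in> Pk I \<Longrightarrow> s \<ge> 2"
proof (induction I arbitrary: s)
  case (Cons i I)
  then consider "s \<ge> 2" | t where "t \<in> Pk I" "s = wt i + t"
    by (auto simp: Pk_Cons split: if_splits)
  then show ?case
    using Cons.IH by cases (auto intro: trans_le_add2)
qed simp

text \<open>All peaks are at least 2, so 2 is a peak exactly if the first column has weight 2; its
  weight is thereby known and can be stripped. \<open>Pk\<close> ignores the last column, whose
  weight is fixed by the oddness assumption.\<close>

lemma wt_eq_if_Pk_eq:
  assumes "\<forall>i\<in>set I. wt i = 1 \<or> wt i = 2" "I \<noteq> [] \<longrightarrow> odd (wt (last I))"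
    and "\<forall>j\<in>set J. wt j = 1 \<or> wt j = 2" "J \<noteq> [] \<longrightarrow> odd (wt (last J))"
    and "Pk I = Pk J" "sum_list (map wt I) = sum_list (map wt J)"
  shows "map wt I = map wt J"
  using assms
proof (induction I arbitrary: J)
  case Nil
  then show ?case
    by (cases J) auto
next
  case (Cons i I)
  then obtain j J' where J: "J = j # J'"
    by (cases J) auto
  have two: "2 \<in> Pk (k # K) \<longleftrightarrow> wt k = 2"
    if "wt k = 1 \<or> wt k = 2" "odd (wt (last (k # K)))" for k K
  proof (cases "wt k = 2")
    case True
    with that(2) have "K \<noteq> []"
      by auto
    with True show ?thesis
      by (simp add: Pk_Cons)
  next
    case False
    with that(1) have "2 \<in> Pk (k # K) \<longleftrightarrow> 1 \<in> Pk K"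
      by (auto simp: Pk_Cons)
    with False show ?thesis
      using Pk_ge_2[of 1 K] by auto
  qed
  have i: "wt i = 1 \<or> wt i = 2" and j: "wt j = 1 \<or> wt j = 2"
    using Cons.prems(1,3) J by simp_all
  have "2 \<in> Pk (i # I) \<longleftrightarrow> wt i = 2" "2 \<in> Pk (j # J') \<longleftrightarrow> wt j = 2"
    using two Cons.prems(2,4) i j J by blast+
  with i j have ij: "wt i = wt j"
    using Cons.prems(5) J by metis
  \<comment> \<open>The shifted peaks exceed \<open>wt k\<close>, because 0 is not a peak; removing
    \<open>wt k\<close> therefore loses none of them.\<close>
  have "Pk (k # K) - {wt k} = (+) (wt k) ` Pk K" for k K
    using Pk_ge_2[of 0 K] by (auto simp: Pk_Cons)
  then have "(+) (wt i) ` Pk I = (+) (wt i) ` Pk J'"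
    using Cons.prems(5) J ij by metis
  then have "Pk I = Pk J'"
    by (simp add: inj_image_eq_iff)
  then have "map wt I = map wt J'"
    using Cons.prems(1-4,6) unfolding J by (intro Cons.IH) (simp_all add: ij split: if_splits)
  with ij J show ?case
    by simp
qed

lemma peak_comp_eqI:
  assumes "is_peak_comp S u I"
  shows "peak_comp S u = I"
  unfolding peak_comp_def
proof (rule the_equality[where P = "is_peak_comp S u", OF assms])
  fix J assume J: "is_peak_comp S u J"
  then have "map wt J = map wt I"
    using assms length_cw[of I] length_cw[of J]
    by (intro wt_eq_if_Pk_eq) (auto simp: is_peak_comp_def)
  with J assms show "J = I"
    by (intro eq_if_cw_eq_wt_eq) (auto simp: is_peak_comp_def)
qed

section \<open>Odd compositions and admissible pairs\<close>

definition odd_vcomps :: "nat \<Rightarrow> vcomp set" where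
  "odd_vcomps l = {I \<in> vcomps l. \<forall>i\<in>set I. odd (wt i)}"

lemma odd_vcompsI:
  assumes "\<forall>i\<in>set I. odd (wt i)" "set (cw I) \<subseteq> {..<l}"
  shows "I \<in> odd_vcomps l"
  using assms unfolding odd_vcomps_def vcomps_def
  by (auto simp: cw_eq set_column_word)

lemma set_cw: "I \<in> vcomps l \<Longrightarrow> set (cw I) \<subseteq> {..<l}"
  by (auto simp: cw_eq set_column_word vcomps_def)

text \<open>The pieces of a sorted word are sorted, so cutting a column leaves the coloring word
  unchanged.\<close>

lemma is_tilde_split_pairs:
  assumes "odd_words ws" "\<forall>w\<in>set ws. sorted w"
  shows "is_tilde (map word_vec ws) (map word_vec (split_pairs ws))"
proof -
  have "cw (map word_vec (split_pairs ws)) = cw (map word_vec ws)"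
    using assms sorted_split_pairs by (simp add: cw_map_word_vec concat_split_pairs)
  moreover have "map word_vec (split_pairs ws) =
      concat (map (\<lambda>w. map word_vec (split_pairs [w])) ws)"
    by (subst split_pairs_eq_concat) (simp add: map_concat comp_def)
  moreover have "sum_list (map word_vec (split_pairs [w])) = word_vec w" for w
    by (simp add: concat_split_pairs flip: word_vec_concat)
  moreover have "split_pairs [w] \<noteq> []" "wt (last (map word_vec (split_pairs [w]))) = 1"
    "\<forall>b\<in>set (butlast (map word_vec (split_pairs [w]))). wt b = 2" if "w \<in> set ws" for w
    using assms(1) that split_pairs_nonempty[of "[w]"] length_last_split_pairs[of "[w]"]
      length_butlast_split_pairs[of w]
    by (auto simp: last_map map_butlast[symmetric])
  ultimately show ?thesis
    unfolding is_tilde_def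
    by (intro conjI exI[of _ "map (\<lambda>w. map word_vec (split_pairs [w])) ws"])
      (simp_all add: list.rel_map list_all2_same)
qed

lemma odd_vcomps_words:
  assumes "K \<in> odd_vcomps l"
  obtains ws where "K = map word_vec ws" "odd_words ws" "\<forall>w\<in>set ws. sorted w"
    "cw K = concat ws" "tilde K = map word_vec (split_pairs ws)"
proof
  let ?ws = "map column_word K"
  show K: "K = map word_vec ?ws"
    by (simp add: map_idI)
  show "odd_words ?ws" "\<forall>w\<in>set ?ws. sorted w"
    using assms by (auto simp: odd_vcomps_def sorted_column_word)
  then have "is_tilde (map word_vec ?ws) (map word_vec (split_pairs ?ws))"
    by (rule is_tilde_split_pairs)
  then show "tilde K = map word_vec (split_pairs ?ws)"
    using K tilde_eqI by metis
  show "cw K = concat ?ws"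
    by (simp add: cw_eq)
qed

text \<open>The blocks of a tilde have weights 2, ..., 2, 1, even except for the last, so they are
  the odd blocks, and summing them undoes the tilde.\<close>

lemma is_tilde_imp:
  assumes "is_tilde K I"
  shows "is_peak_comp (Pk I) (cw K) I" "odd_comp I = K"
proof -
  from assms obtain Bs where I: "I = concat Bs" and cw: "cw I = cw K" and
    all: "list_all2 (\<lambda>i B. sum_list B = i \<and> B \<noteq> [] \<and>
                     (\<forall>b\<in>set (butlast B). wt b = 2) \<and> wt (last B) = 1) K Bs"
    by (auto simp: is_tilde_def)
  have Bs: "B \<noteq> []" "\<forall>b\<in>set (butlast B). wt b = 2" "wt (last B) = 1" if "B \<in> set Bs" for B
    using all that by (auto simp: list_all2_conv_all_nth in_set_conv_nth[of B])
  have K: "K = map sum_list Bs"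
    using all by (auto simp: list_all2_conv_all_nth intro: nth_equalityI)
  show "odd_comp I = K"
    unfolding K by (rule odd_comp_eqI) (auto simp: odd_blocks_def I Bs)
  have "wt i = 1 \<or> wt i = 2" if "i \<in> set I" for i
  proof -
    from that obtain B where B: "B \<in> set Bs" "i \<in> set B"
      by (auto simp: I)
    then have "i \<in> set (butlast B) \<or> i = last B"
      by (cases B rule: rev_cases) auto
    with Bs[OF B(1)] show ?thesis
      by auto
  qed
  moreover have "odd (wt (last I))" if "I \<noteq> []"
  proof -
    from that I obtain Cs B where BsC: "Bs = Cs @ [B]"
      by (metis concat.simps(1) append_butlast_last_id)
    with I Bs[of B] show ?thesis
      by simp
  qed
  ultimately show "is_peak_comp (Pk I) (cw K) I"
    unfolding is_peak_comp_def using cw by blast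
qed

lemma odd_vcomps_tilde:
  assumes "K \<in> odd_vcomps l"
  shows "(Pk (tilde K), cw K) \<in> admissible l"
    and "odd_comp (peak_comp (Pk (tilde K)) (cw K)) = K"
proof -
  from assms obtain ws where ws: "K = map word_vec ws" "odd_words ws" "\<forall>w\<in>set ws. sorted w"
    "cw K = concat ws" "tilde K = map word_vec (split_pairs ws)"
    by (rule odd_vcomps_words)
  then have "is_tilde K (tilde K)"
    using is_tilde_split_pairs by metis
  note * = is_tilde_imp[OF this]
  show "odd_comp (peak_comp (Pk (tilde K)) (cw K)) = K"
    using * peak_comp_eqI by metis
  moreover have "set (cw K) \<subseteq> {..<l}"
    using assms set_cw by (auto simp: odd_vcomps_def)
  moreover have "peak_subset (length (cw K)) (Pk (tilde K))"
    unfolding ws(4,5) using peak_subset_peaks ws(2) by simp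
  ultimately show "(Pk (tilde K), cw K) \<in> admissible l"
    unfolding admissible_def using *(1) by auto
qed

text \<open>Odd blocks with columns of weights 1 and 2 have the shape 2, ..., 2, 1 of tilde blocks.
  The condition on coloring words in \<open>admissible\<close> is the remaining part of
  \<open>is_tilde\<close>.\<close>

lemma admissible_odd_vcomps:
  assumes "(S, u) \<in> admissible l"
  defines "K \<equiv> odd_comp (peak_comp S u)"
  shows "K \<in> odd_vcomps l" "cw K = u" "Pk (tilde K) = S"
proof -
  from assms obtain I where I: "is_peak_comp S u I" and u: "set u \<subseteq> {..<l}" and cw: "cw K = u"
    by (auto simp: admissible_def)
  obtain Bs where Bs: "odd_blocks I Bs"
    using ex_odd_blocks I unfolding is_peak_comp_def by blast
  have K: "K = map sum_list Bs"
    unfolding K_def peak_comp_eqI[OF I] by (rule odd_comp_eqI[OF Bs])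
  have I12: "wt i = 1 \<or> wt i = 2" if "B \<in> set Bs" "i \<in> set B" for B i
    using that Bs I unfolding odd_blocks_def is_peak_comp_def by fastforce
  have B: "B \<noteq> []" "wt (last B) = 1" "\<forall>i\<in>set (butlast B). wt i = 2" if "B \<in> set Bs" for B
  proof -
    have *: "B \<noteq> []" "odd (wt (last B))" "\<forall>i\<in>set (butlast B). even (wt i)"
      using Bs that by (auto simp: odd_blocks_def)
    then show "B \<noteq> []" "wt (last B) = 1" "\<forall>i\<in>set (butlast B). wt i = 2"
      using I12[OF that] last_in_set in_set_butlastD by fastforce+
  qed
  have "odd (wt (sum_list B))" if "B \<in> set Bs" for B
  proof -
    have "sum_list (map wt B) = 2 * (wt (sum_list B) div 2) + 1"
      by (subst map_wt_tilde_block) (use B[OF that] in \<open>auto simp: sum_list_replicate\<close>)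
    then have "wt (sum_list B) = 2 * (wt (sum_list B) div 2) + 1"
      by (simp add: wt_sum_list)
    then show ?thesis
      by presburger
  qed
  then show "K \<in> odd_vcomps l"
    using cw u by (intro odd_vcompsI) (auto simp: K)
  show "cw K = u" by (fact cw)
  have "is_tilde K I"
    unfolding is_tilde_def using I cw Bs B
    by (intro conjI exI[of _ Bs])
      (simp_all add: is_peak_comp_def odd_blocks_def K list.rel_map list_all2_same)
  then show "Pk (tilde K) = S"
    using I tilde_eqI by (auto simp: is_peak_comp_def)
qed

text \<open>Fewer peaks mean that fewer letters have to share a sorted column.\<close>

lemma admissible_subset:
  assumes "(S, u) \<in> admissible l" "T \<subseteq> S"
  shows "(T, u) \<in> admissible l"
proof -
  define K where "K = odd_comp (peak_comp S u)"
  have K: "K \<in> odd_vcomps l" "cw K = u" "Pk (tilde K) = S"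
    using admissible_odd_vcomps[OF assms(1)] by (simp_all add: K_def)
  then obtain ws where ws: "K = map word_vec ws" "odd_words ws" "\<forall>w\<in>set ws. sorted w"
    "cw K = concat ws" "tilde K = map word_vec (split_pairs ws)"
    by (metis odd_vcomps_words)
  then obtain vs where vs: "odd_words vs" "\<forall>w\<in>set vs. sorted w" "concat vs = concat ws"
      "peaks vs = T"
    using ex_peaks_eq_subset[of ws T] assms(2) K(3) by metis
  let ?K = "map word_vec vs"
  have cw: "cw ?K = u"
    using vs ws(4) K(2) by (simp add: cw_map_word_vec)
  have "?K \<in> odd_vcomps l"
    using vs(1) cw K(1) K(2) set_cw[of K l]
    by (intro odd_vcompsI) (auto simp: odd_vcomps_def)
  moreover have "tilde ?K = map word_vec (split_pairs vs)"
    using is_tilde_split_pairs vs tilde_eqI by blast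
  ultimately show ?thesis
    using odd_vcomps_tilde(1)[of ?K l] cw vs(4) by simp
qed

lemma finite_Pk [simp]: "finite (Pk I)"
  by (induction I) (auto simp: Pk_Cons)


section \<open>The functions eta and theta\<close>

lemma eta_odd_vcomps:
  assumes "K \<in> odd_vcomps l"
  shows "eta K = (\<Sum>J | J \<unlhd> E (cw K) \<and> Pk (tilde K) \<inter> (D J \<union> Suc ` D J) = {}.
                    scl (2 ^ length J) (M J))"
proof -
  from assms obtain ws where ws: "K = map word_vec ws" "odd_words ws" "\<forall>w\<in>set ws. sorted w"
    "cw K = concat ws" "tilde K = map word_vec (split_pairs ws)"
    by (rule odd_vcomps_words)
  show ?thesis
    unfolding eta_def ws(4,5) unfolding ws(1) coarsens_odd_words_iff[OF ws(2)] ..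
qed

lemma sum_Pow_sign:
  assumes "finite X"
  shows "(\<Sum>T\<in>Pow X. (- 1) ^ card T) = (if X = {} then 1 else 0 :: rat)"
  using assms
proof (induction X rule: finite_induct)
  case (insert x X)
  have "(\<Sum>T\<in>insert x ` Pow X. (- 1) ^ card T) = (\<Sum>T\<in>Pow X. - ((- 1) ^ card T) :: rat)"
  proof (subst sum.reindex)
    show "inj_on (insert x) (Pow X)"
      using insert by (auto simp: inj_on_def)
    show "(\<Sum>T\<in>Pow X. ((\<lambda>T. (- 1) ^ card T) \<circ> insert x) T) = (\<Sum>T\<in>Pow X. - ((- 1) ^ card T) :: rat)"
    proof (rule sum.cong)
      fix T assume "T \<in> Pow X"
      then have "finite T" "x \<notin> T"
        using insert finite_subset by auto
      then show "((\<lambda>T. (- 1) ^ card T) \<circ> insert x) T = - ((- 1) ^ card T :: rat)"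
        by simp
    qed simp
  qed
  moreover have "Pow X \<inter> insert x ` Pow X = {}"
    using insert by auto
  ultimately show ?case
    using insert by (simp add: Pow_insert sum.union_disjoint sum_negf)
qed simp

text \<open>The common form of both expansions. For \<open>Q\<close> meaning "covered by J",
  \<open>R J\<close> is the covered part of \<open>P\<close>; for "avoided by J" it is the uncovered
  part. After exchanging the sums, each \<open>J\<close> carries the signed count of the subsets of
  \<open>R J\<close>.\<close>

lemma sum_Pow_sign_filter:
  fixes f :: "'b \<Rightarrow> 'c \<Rightarrow> rat"
  assumes "finite P" "finite {J. A J}" "\<And>J. {S \<in> Pow P. Q S J} = Pow (R J)"
  shows "(\<Sum>S\<in>Pow P. scl ((- 1) ^ card S) (\<Sum>J | A J \<and> Q S J. f J)) =
         (\<Sum>J | A J \<and> R J = {}. f J)"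
proof -
  have fin: "finite (R J)" for J
  proof -
    have "finite {S \<in> Pow P. Q S J}"
      using assms(1) by simp
    then show ?thesis
      by (simp only: assms(3) finite_Pow_iff)
  qed
  have A: "(\<Sum>J | A J \<and> B J. g J) = (\<Sum>J | A J. if B J then g J else 0)"
    for B and g :: "'b \<Rightarrow> 'c \<Rightarrow> rat"
    using sum.inter_filter[OF assms(2), of g B] by simp
  have "(\<Sum>S\<in>Pow P. scl ((- 1) ^ card S) (\<Sum>J | A J \<and> Q S J. f J)) =
        (\<Sum>S\<in>Pow P. \<Sum>J | A J. if Q S J then scl ((- 1) ^ card S) (f J) else 0)"
    unfolding A fs.scale_sum_right
    by (intro sum.cong) auto
  also have "\<dots> = (\<Sum>J | A J. \<Sum>S\<in>Pow P. if Q S J then scl ((- 1) ^ card S) (f J) else 0)"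
    by (rule sum.swap)
  also have "\<dots> = (\<Sum>J | A J. scl (\<Sum>S\<in>Pow (R J). (- 1) ^ card S) (f J))"
    using assms(1) by (simp only: sum.inter_filter[symmetric] finite_Pow_iff assms(3) fs.scale_sum_left)
  also have "\<dots> = (\<Sum>J | A J. if R J = {} then f J else 0)"
    using fin by (intro sum.cong) (auto simp: sum_Pow_sign)
  also have "\<dots> = (\<Sum>J | A J \<and> R J = {}. f J)"
    by (rule A[symmetric])
  finally show ?thesis .
qed

lemma eta_eq_sum_theta:
  assumes "K \<in> odd_vcomps l"
  shows "eta K = (\<Sum>S\<in>Pow (Pk (tilde K)). scl ((- 1) ^ card S) (theta S (cw K)))"
  unfolding theta_def eta_odd_vcomps[OF assms]
  by (rule sum_Pow_sign_filter[symmetric]) auto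

lemma theta_eq_sum_eta:
  assumes "(S, u) \<in> admissible l"
  shows "theta S u = (\<Sum>T\<in>Pow S. scl ((- 1) ^ card T) (eta (odd_comp (peak_comp T u))))"
proof -
  have fin: "finite S"
    by (subst admissible_odd_vcomps(3)[OF assms, symmetric]) (rule finite_Pk)
  have "eta (odd_comp (peak_comp T u)) =
      (\<Sum>J | J \<unlhd> E u \<and> T \<inter> (D J \<union> Suc ` D J) = {}. scl (2 ^ length J) (M J))" if "T \<subseteq> S" for T
    using eta_odd_vcomps[OF admissible_odd_vcomps(1)[OF admissible_subset[OF assms that]]]
    by (simp only: admissible_odd_vcomps(2,3)[OF admissible_subset[OF assms that]])
  then have "(\<Sum>T\<in>Pow S. scl ((- 1) ^ card T) (eta (odd_comp (peak_comp T u)))) =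
      (\<Sum>T\<in>Pow S. scl ((- 1) ^ card T)
        (\<Sum>J | J \<unlhd> E u \<and> T \<inter> (D J \<union> Suc ` D J) = {}. scl (2 ^ length J) (M J)))"
    by (intro sum.cong) auto
  also have "\<dots> = (\<Sum>J | J \<unlhd> E u \<and> S - (D J \<union> Suc ` D J) = {}. scl (2 ^ length J) (M J))"
    using fin by (intro sum_Pow_sign_filter) auto
  finally show ?thesis
    by (simp add: theta_def)
qed

section \<open>Linear algebra in the monomial basis\<close>

lemma span_image_explicit:
  assumes "x \<in> fs.span (f ` A)"
  obtains F c where "finite F" "F \<subseteq> A" "x = (\<Sum>a\<in>F. scl (c a) (f a))"
proof -
  have "\<exists>F c. finite F \<and> F \<subseteq> A \<and> x = (\<Sum>a\<in>F. scl (c a) (f a))"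
    using assms
  proof (induction rule: fs.span_induct_alt)
    case base
    show ?case
      by (intro exI[of _ "{}"]) auto
  next
    case (step r y z)
    then obtain F c a where F: "finite F" "F \<subseteq> A" "z = (\<Sum>a\<in>F. scl (c a) (f a))"
      and a: "a \<in> A" "y = f a"
      by blast
    \<comment> \<open>Adding two indicator terms treats the cases \<open>a\<close> in
      \<open>F\<close> and \<open>a\<close> not in \<open>F\<close> at once.\<close>
    have "scl r (f a) + z = (\<Sum>b\<in>insert a F. scl ((if b \<in> F then c b else 0) + (if b = a then r else 0)) (f b))"
    proof -
      have "(\<Sum>b\<in>insert a F. scl (if b \<in> F then c b else 0) (f b)) = z"
        unfolding F(3) using F(1) by (intro sum.mono_neutral_cong_right) auto
      moreover have "(\<Sum>b\<in>insert a F. scl (if b = a then r else 0) (f b)) =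
          (\<Sum>b\<in>insert a F. if b = a then scl r (f b) else 0)"
        by (intro sum.cong) auto
      moreover have "\<dots> = scl r (f a)"
        using F(1) by (simp only: sum.delta finite_insert insert_iff simp_thms if_True)
      ultimately show ?thesis
        by (simp add: fs.scale_left_distrib sum.distrib add.commute del: sum.insert)
    qed
    with F a show ?case
      by (intro exI[of _ "insert a F"] exI) auto
  qed
  with that show ?thesis
    by blast
qed

lemma sum_apply:
  fixes f :: "'b \<Rightarrow> 'c \<Rightarrow> rat"
  shows "(\<Sum>a\<in>X. f a) x = (\<Sum>a\<in>X. f a x)"
  by (induction X rule: infinite_finite_induct) auto

lemma M_coeff_add [simp]: "M_coeff (f + g) I = M_coeff f I + M_coeff g I"
  by (simp add: M_coeff_def)

lemma M_coeff_diff [simp]: "M_coeff (f - g) I = M_coeff f I - M_coeff g I"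
  by (simp add: M_coeff_def)

lemma M_coeff_scl [simp]: "M_coeff (scl a f) I = a * M_coeff f I"
  by (simp add: M_coeff_def scl_def)

lemma M_coeff_zero [simp]: "M_coeff 0 I = 0"
  by (simp add: M_coeff_def)

lemma M_coeff_sum: "M_coeff (sum f A) I = (\<Sum>a\<in>A. M_coeff (f a) I)"
  by (induction A rule: infinite_finite_induct)
    (simp_all only: sum.infinite sum.empty sum.insert M_coeff_add M_coeff_zero not_False_eq_True)

lemma M_coeff_sum_M:
  assumes "finite F" "\<forall>I\<in>F. 0 \<notin> set I" "0 \<notin> set J"
  shows "M_coeff (\<Sum>I\<in>F. scl (c I) (M I)) J = (if J \<in> F then c J else 0)"
proof -
  have "M_coeff (\<Sum>I\<in>F. scl (c I) (M I)) J = (\<Sum>I\<in>F. if I = J then c I else 0)"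
    unfolding M_coeff_sum using assms by (intro sum.cong) (auto simp: M_coeff_M)
  then show ?thesis
    using assms(1) by simp
qed

lemma span_M:
  assumes "h \<in> fs.span (M ` X)" "\<forall>I\<in>X. 0 \<notin> set I"
  shows "finite (M_supp h)" "M_supp h \<subseteq> X" "h = (\<Sum>I\<in>M_supp h. scl (M_coeff h I) (M I))"
proof -
  from assms(1) obtain F c where F: "finite F" "F \<subseteq> X" "h = (\<Sum>I\<in>F. scl (c I) (M I))"
    by (rule span_image_explicit)
  have F0: "\<forall>I\<in>F. 0 \<notin> set I"
    using F(2) assms(2) by blast
  have coeff: "M_coeff h J = (if J \<in> F then c J else 0)" if "0 \<notin> set J" for J
    unfolding F(3) by (rule M_coeff_sum_M[OF F(1) F0 that])
  then have supp: "M_supp h = {J \<in> F. c J \<noteq> 0}"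
    using F0 by (auto simp: M_supp_def split: if_splits)
  then show "finite (M_supp h)" "M_supp h \<subseteq> X"
    using F by auto
  have "(\<Sum>I\<in>M_supp h. scl (M_coeff h I) (M I)) = (\<Sum>I\<in>F. scl (c I) (M I))"
    using F(1) F0 coeff unfolding supp by (intro sum.mono_neutral_cong_left) auto
  then show "h = (\<Sum>I\<in>M_supp h. scl (M_coeff h I) (M I))"
    using F(3) by simp
qed

lemma vcomps_nonzero: "I \<in> vcomps l \<Longrightarrow> 0 \<notin> set I"
  by (auto simp: vcomps_def)

lemma QSym_M_supp:
  assumes "h \<in> QSym l"
  shows "finite (M_supp h)" "M_supp h \<subseteq> vcomps l" "h = (\<Sum>I\<in>M_supp h. scl (M_coeff h I) (M I))"
  using span_M[of h "vcomps l"] assms vcomps_nonzero unfolding QSym_def by blast+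

lemma QSym_eq_0:
  assumes "h \<in> QSym l" "\<And>I. 0 \<notin> set I \<Longrightarrow> M_coeff h I = 0"
  shows "h = 0"
proof -
  have "M_supp h = {}"
    using assms(2) by (auto simp: M_supp_def)
  with QSym_M_supp(3)[OF assms(1)] show ?thesis
    by simp
qed

lemma subspace_QSym: "fs.subspace (QSym l)"
  by (simp add: QSym_def)

lemma M_in_QSym: "I \<in> vcomps l \<Longrightarrow> M I \<in> QSym l"
  by (auto simp: QSym_def intro: fs.span_base)

text \<open>Supports shrink when coefficients cancel; a common finite index set for
  \<open>f\<close>, \<open>g\<close> and \<open>f + g\<close> makes linearity a matter of
  coefficients.\<close>

lemma M_functional_superset:
  assumes "finite F" "M_supp h \<subseteq> F" "\<forall>I\<in>F. 0 \<notin> set I"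
  shows "M_functional \<phi> h = (\<Sum>I\<in>F. M_coeff h I * \<phi> I)"
  unfolding M_functional_def using assms
  by (intro sum.mono_neutral_left) (auto simp: M_supp_def)

lemma coprod_superset:
  assumes "finite F" "M_supp h \<subseteq> F" "\<forall>I\<in>F. 0 \<notin> set I"
  shows "coprod h = (\<Sum>I\<in>F. scl (M_coeff h I) (\<Sum>k\<le>length I. tensor (M (take k I)) (M (drop k I))))"
  unfolding coprod_def using assms
  by (intro sum.mono_neutral_left) (auto simp: M_supp_def)

lemma M_supp_subset:
  "M_supp (f + g) \<subseteq> M_supp f \<union> M_supp g" "M_supp (scl a f) \<subseteq> M_supp f"
  by (auto simp: M_supp_def)

lemma M_functional_add:
  assumes "f \<in> QSym l" "g \<in> QSym l"
  shows "M_functional \<phi> (f + g) = M_functional \<phi> f + M_functional \<phi> g"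
proof -
  let ?F = "M_supp f \<union> M_supp g"
  have F: "finite ?F" "\<forall>I\<in>?F. 0 \<notin> set I"
    using QSym_M_supp(1) assms by (auto simp: M_supp_def)
  show ?thesis
    using M_functional_superset[OF F(1) _ F(2), of _ \<phi>] M_supp_subset(1)[of f g]
    by (simp add: algebra_simps sum.distrib)
qed

lemma M_functional_scl:
  assumes "f \<in> QSym l"
  shows "M_functional \<phi> (scl a f) = a * M_functional \<phi> f"
proof -
  have F: "finite (M_supp f)" "\<forall>I\<in>M_supp f. 0 \<notin> set I"
    using QSym_M_supp(1) assms by (auto simp: M_supp_def)
  show ?thesis
    using M_functional_superset[OF F(1) _ F(2), of _ \<phi>] M_supp_subset(2)[of a f]
    by (simp add: sum_distrib_left mult.assoc)
qed

lemma linear_M_functional: "linear_on_QSym l (M_functional \<phi>)"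
  by (auto simp: linear_on_QSym_def M_functional_add M_functional_scl)

lemma linear_on_QSymD:
  assumes "linear_on_QSym l \<phi>"
  shows "h \<in> QSym l \<Longrightarrow> k \<in> QSym l \<Longrightarrow> \<phi> (h + k) = \<phi> h + \<phi> k"
    and "h \<in> QSym l \<Longrightarrow> \<phi> (scl a h) = a * \<phi> h"
  using assms unfolding linear_on_QSym_def by blast+

lemma linear_combination_in_QSym:
  assumes "\<And>a. a \<in> F \<Longrightarrow> g a \<in> QSym l"
  shows "(\<Sum>a\<in>F. scl (c a) (g a)) \<in> QSym l"
  by (intro fs.subspace_sum fs.subspace_scale subspace_QSym assms)

lemma linear_on_QSym_sum:
  assumes "linear_on_QSym l \<phi>" "finite F" "\<And>a. a \<in> F \<Longrightarrow> g a \<in> QSym l"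
  shows "\<phi> (\<Sum>a\<in>F. scl (c a) (g a)) = (\<Sum>a\<in>F. c a * \<phi> (g a))"
  using assms(2,3)
proof (induction F rule: finite_induct)
  case empty
  have "\<phi> (scl 0 0) = 0 * \<phi> 0"
    by (rule linear_on_QSymD(2)[OF assms(1) fs.subspace_0[OF subspace_QSym]])
  then show ?case
    by (simp only: fs.scale_zero_left sum.empty mult_zero_left)
next
  case (insert a F)
  have ga: "g a \<in> QSym l" and F: "\<And>b. b \<in> F \<Longrightarrow> g b \<in> QSym l"
    using insert.prems by blast+
  have "\<phi> (scl (c a) (g a) + (\<Sum>a\<in>F. scl (c a) (g a))) =
      \<phi> (scl (c a) (g a)) + \<phi> (\<Sum>a\<in>F. scl (c a) (g a))"
    by (intro linear_on_QSymD(1)[OF assms(1)] linear_combination_in_QSym F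
        fs.subspace_scale subspace_QSym ga)
  also have "\<dots> = c a * \<phi> (g a) + (\<Sum>a\<in>F. c a * \<phi> (g a))"
    unfolding linear_on_QSymD(2)[OF assms(1) ga] using insert.IH F by presburger
  finally show ?case
    by (simp only: sum.insert[OF insert.hyps])
qed

lemma linear_on_QSym_eq:
  assumes "linear_on_QSym l \<phi>" "linear_on_QSym l \<psi>" "\<And>I. I \<in> vcomps l \<Longrightarrow> \<phi> (M I) = \<psi> (M I)"
    and "h \<in> QSym l"
  shows "\<phi> h = \<psi> h"
proof -
  note h = QSym_M_supp[OF assms(4)]
  have "\<phi> (\<Sum>I\<in>M_supp h. scl (M_coeff h I) (M I)) = \<psi> (\<Sum>I\<in>M_supp h. scl (M_coeff h I) (M I))"
    using h(1,2) M_in_QSym assms(3)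
    by (subst (1 2) linear_on_QSym_sum) (use assms in \<open>auto intro!: sum.cong\<close>)
  with h(3) show ?thesis
    by simp
qed

lemma coprod_add:
  assumes "f \<in> QSym l" "g \<in> QSym l"
  shows "coprod (f + g) = coprod f + coprod g"
proof -
  let ?F = "M_supp f \<union> M_supp g"
  have F: "finite ?F" "\<forall>I\<in>?F. 0 \<notin> set I"
    using QSym_M_supp(1) assms by (auto simp: M_supp_def)
  show ?thesis
    using coprod_superset[OF F(1) _ F(2)] M_supp_subset(1)[of f g]
    by (simp add: fs.scale_left_distrib sum.distrib)
qed

lemma coprod_scl:
  assumes "f \<in> QSym l"
  shows "coprod (scl a f) = scl a (coprod f)"
proof -
  have F: "finite (M_supp f)" "\<forall>I\<in>M_supp f. 0 \<notin> set I"
    using QSym_M_supp(1) assms by (auto simp: M_supp_def)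
  show ?thesis
    using coprod_superset[OF F(1) _ F(2)] M_supp_subset(2)[of a f]
    by (simp add: fs.scale_sum_right)
qed

lemma coprod_sum:
  assumes "finite F" "\<And>a. a \<in> F \<Longrightarrow> g a \<in> QSym l"
  shows "coprod (\<Sum>a\<in>F. scl (c a) (g a)) = (\<Sum>a\<in>F. scl (c a) (coprod (g a)))"
  using assms
proof (induction F rule: finite_induct)
  case empty
  have "M_supp 0 = {}"
    by (simp only: M_supp_def M_coeff_zero simp_thms empty_def)
  then show ?case
    by (simp only: coprod_def sum.empty)
next
  case (insert a F)
  have ga: "g a \<in> QSym l" and F: "\<And>b. b \<in> F \<Longrightarrow> g b \<in> QSym l"
    using insert.prems by blast+
  have "coprod (scl (c a) (g a) + (\<Sum>a\<in>F. scl (c a) (g a))) =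
      coprod (scl (c a) (g a)) + coprod (\<Sum>a\<in>F. scl (c a) (g a))"
    by (intro coprod_add[of _ l] linear_combination_in_QSym F fs.subspace_scale subspace_QSym ga)
  also have "\<dots> = scl (c a) (coprod (g a)) + (\<Sum>a\<in>F. scl (c a) (coprod (g a)))"
    unfolding coprod_scl[OF ga] using insert.IH F by presburger
  finally show ?case
    by (simp only: sum.insert[OF insert.hyps])
qed

text \<open>Deconcatenation in coordinates: the pair (A, B) arises only from \<open>A @ B\<close>,
  by the one cut at \<open>length A\<close>.\<close>

lemma coprod_coeff:
  assumes "h \<in> QSym l" "0 \<notin> set A" "0 \<notin> set B"
  shows "coprod h (xmono [0..<length A] A, xmono [0..<length B] B) = M_coeff h (A @ B)"
proof -
  note h = QSym_M_supp[OF assms(1)]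
  have nz: "0 \<notin> set I" if "I \<in> M_supp h" for I
    using that by (auto simp: M_supp_def)
  have "coprod h (xmono [0..<length A] A, xmono [0..<length B] B) =
    (\<Sum>I\<in>M_supp h. M_coeff h I * (\<Sum>k\<le>length I. M_coeff (M (take k I)) A * M_coeff (M (drop k I)) B))"
    by (simp add: coprod_def sum_apply scl_def tensor_def M_coeff_def)
  also have "\<dots> = (\<Sum>I\<in>M_supp h. M_coeff h I * (\<Sum>k\<le>length I. if k = length A \<and> I = A @ B then 1 else 0))"
  proof (intro sum.cong refl arg_cong2[where f = "(*)"])
    fix I k assume I: "I \<in> M_supp h" and k: "k \<in> {..length I}"
    have "0 \<notin> set (take k I)" "0 \<notin> set (drop k I)"
      using nz[OF I] by (auto dest: in_set_takeD in_set_dropD)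
    moreover have "take k I = A \<and> drop k I = B \<longleftrightarrow> k = length A \<and> I = A @ B"
      using k by (auto simp: append_eq_conv_conj)
    ultimately show "M_coeff (M (take k I)) A * M_coeff (M (drop k I)) B =
        (if k = length A \<and> I = A @ B then 1 else 0)"
      using assms by (auto simp: M_coeff_M)
  qed
  also have "\<dots> = (\<Sum>I\<in>M_supp h. if I = A @ B then M_coeff h I else 0)"
    by (intro sum.cong) auto
  also have "\<dots> = M_coeff h (A @ B)"
    using h(1) assms by (auto simp: M_supp_def)
  finally show ?thesis .
qed


section \<open>The functional zeta and its inverse\<close>

lemma vcomps_take_drop: "I \<in> vcomps l \<Longrightarrow> take k I \<in> vcomps l" "I \<in> vcomps l \<Longrightarrow> drop k I \<in> vcomps l"
  by (auto simp: vcomps_def dest: in_set_takeD in_set_dropD)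

lemma zetaQ_M: "0 \<notin> set I \<Longrightarrow> zetaQ (M I) = (if length I \<le> 1 then 1 else 0)"
  by (simp add: zetaQ_def M_functional_M)

lemma conv_M:
  "0 \<notin> set I \<Longrightarrow> conv f g (M I) = (\<Sum>k\<le>length I. f (M (take k I)) * g (M (drop k I)))"
  by (simp add: conv_def M_functional_M)

lemma counit_M: "0 \<notin> set I \<Longrightarrow> counit (M I) = (if I = [] then 1 else 0)"
  by (simp add: counit_def M_functional_M)

text \<open>\<open>zetaQ\<close> vanishes on prefixes with more than one column, so only the cuts 0
  and 1 survive.\<close>

lemma conv_zetaQ_left:
  assumes "0 \<notin> set I"
  shows "conv zetaQ g (M I) = g (M I) + (if I = [] then 0 else g (M (tl I)))"
proof (cases I)
  case (Cons i I')
  have "zetaQ (M (take k I)) = (if k \<le> 1 then 1 else 0)" if "k \<le> length I" for k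
    using assms that by (subst zetaQ_M) (auto dest: in_set_takeD)
  then have "conv zetaQ g (M I) = (\<Sum>k\<le>length I. if k \<in> {0, 1} then g (M (drop k I)) else 0)"
    unfolding conv_M[OF assms] by (intro sum.cong) auto
  also have "\<dots> = (\<Sum>k\<in>{0, 1}. g (M (drop k I)))"
    using Cons by (subst sum.inter_restrict[symmetric]) (auto intro!: sum.cong)
  finally show ?thesis
    using Cons by simp
qed (use assms in \<open>simp add: conv_M zetaQ_M\<close>)

lemma conv_zetaQ_right:
  assumes "0 \<notin> set I"
  shows "conv g zetaQ (M I) = g (M I) + (if I = [] then 0 else g (M (butlast I)))"
proof (cases "I = []")
  case False
  have "zetaQ (M (drop k I)) = (if length I - k \<le> 1 then 1 else 0)" for k
    using assms by (subst zetaQ_M) (auto dest: in_set_dropD)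
  then have "conv g zetaQ (M I) =
      (\<Sum>k\<le>length I. if k \<in> {length I, length I - 1} then g (M (take k I)) else 0)"
    unfolding conv_M[OF assms] by (intro sum.cong) auto
  also have "\<dots> = (\<Sum>k\<in>{length I, length I - 1}. g (M (take k I)))"
    using False by (subst sum.inter_restrict[symmetric]) (auto intro!: sum.cong)
  also have "\<dots> = g (M (take (length I) I)) + g (M (take (length I - 1) I))"
    using False by (subst sum.insert) (cases I; simp)+
  finally show ?thesis
    using False by (simp add: butlast_conv_take)
qed (use assms in \<open>simp add: conv_M zetaQ_M\<close>)

text \<open>In the two-term formulas the terms cancel if the functional changes sign with each
  column.\<close>

lemma conv_inverse_zetaQ: "conv_inverse l zetaQ (M_functional (\<lambda>I. (- 1) ^ length I))"
proof -
  let ?g = "M_functional (\<lambda>I. (- 1) ^ length I)"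
  have g: "?g (M I) = (- 1) ^ length I" if "0 \<notin> set I" for I
    using that by (rule M_functional_M)
  have lin: "linear_on_QSym l (conv \<phi> \<psi>)" "linear_on_QSym l counit" for \<phi> \<psi>
    by (simp_all add: conv_def counit_def linear_M_functional)
  have *: "conv zetaQ ?g (M I) = counit (M I)" "conv ?g zetaQ (M I) = counit (M I)"
    if "I \<in> vcomps l" for I
  proof -
    have I: "0 \<notin> set I"
      using that by (rule vcomps_nonzero)
    have "0 \<notin> set (tl I)"
      using I by (cases I) simp_all
    then show "conv zetaQ ?g (M I) = counit (M I)"
      unfolding conv_zetaQ_left[OF I] counit_M[OF I] using g[of I] g[of "tl I"] I
      by (cases I) simp_all
    have "0 \<notin> set (butlast I)"
      using I in_set_butlastD by metis
    then show "conv ?g zetaQ (M I) = counit (M I)"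
      unfolding conv_zetaQ_right[OF I] counit_M[OF I] using g[of I] g[of "butlast I"] I
      by (cases I rule: rev_cases) simp_all
  qed
  show ?thesis
    unfolding conv_inverse_def
    using linear_on_QSym_eq[OF lin *(1)] linear_on_QSym_eq[OF lin *(2)]
    by (intro conjI ballI linear_M_functional) assumption+
qed

text \<open>Whatever inverse \<open>SOME\<close> picks, the equation for \<open>conv zetaQ\<close>
  determines its values recursively on the number of columns.\<close>

lemma zetaQ_inv_eq:
  assumes "h \<in> QSym l"
  shows "zetaQ_inv l h = M_functional (\<lambda>I. (- 1) ^ length I) h"
proof -
  have inv: "conv_inverse l zetaQ (zetaQ_inv l)"
    unfolding zetaQ_inv_def by (rule someI[of "conv_inverse l zetaQ", OF conv_inverse_zetaQ])
  have "zetaQ_inv l (M I) = (- 1) ^ length I" if "I \<in> vcomps l" for I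
    using that
  proof (induction I)
    case Nil
    then have "conv zetaQ (zetaQ_inv l) (M []) = counit (M [])"
      using inv M_in_QSym by (auto simp: conv_inverse_def)
    then show ?case
      by (simp add: conv_zetaQ_left counit_M)
  next
    case (Cons i I)
    then have "conv zetaQ (zetaQ_inv l) (M (i # I)) = counit (M (i # I))"
      using inv M_in_QSym by (auto simp: conv_inverse_def)
    moreover have "0 \<notin> set (i # I)" "I \<in> vcomps l"
      using Cons.prems by (auto simp: vcomps_def)
    ultimately show ?case
      using Cons.IH by (simp add: conv_zetaQ_left counit_M)
  qed
  then have "zetaQ_inv l (M I) = M_functional (\<lambda>I. (- 1) ^ length I) (M I)" if "I \<in> vcomps l" for I
    using that by (simp add: M_functional_M vcomps_nonzero)
  moreover have "linear_on_QSym l (zetaQ_inv l)"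
    using inv by (simp add: conv_inverse_def)
  ultimately show ?thesis
    using linear_on_QSym_eq[OF _ linear_M_functional _ assms] by blast
qed

lemma zetaQ_bar_eq:
  assumes "h \<in> QSym l"
  shows "zetaQ_bar h = M_functional (\<lambda>I. if length I \<le> 1 then (- 1) ^ wt (sum_list I) else 0) h"
proof -
  note h = QSym_M_supp[OF assms]
  have "zetaQ (deg_part n h) =
      (\<Sum>I\<in>{I \<in> M_supp h. sum_list I = n}. M_coeff h I * (if length I \<le> 1 then 1 else 0))" for n
  proof -
    have "zetaQ (deg_part n h) = (\<Sum>I\<in>{I \<in> M_supp h. sum_list I = n}. M_coeff h I * zetaQ (M I))"
      unfolding deg_part_def zetaQ_def using h(1,2) M_in_QSym
      by (intro linear_on_QSym_sum[OF linear_M_functional]) auto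
    then show ?thesis
      by (auto simp: zetaQ_M M_supp_def intro!: sum.cong)
  qed
  then have "zetaQ_bar h = (\<Sum>n\<in>sum_list ` M_supp h. \<Sum>I\<in>{I \<in> M_supp h. sum_list I = n}.
      M_coeff h I * (if length I \<le> 1 then (- 1) ^ wt (sum_list I) else 0))"
    unfolding zetaQ_bar_def by (auto simp: sum_distrib_left intro!: sum.cong)
  also have "\<dots> = M_functional (\<lambda>I. if length I \<le> 1 then (- 1) ^ wt (sum_list I) else 0) h"
    unfolding M_functional_def using h(1) by (rule sum.image_gen[symmetric])
  finally show ?thesis .
qed

section \<open>The coalgebra spanned by the odd eta functions\<close>

lemma M_coeff_eta:
  assumes "0 \<notin> set I" "0 \<notin> set J"
  shows "M_coeff (eta I) J = (if J \<unlhd> I then 2 ^ length J else 0)"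
  unfolding eta_def
  by (subst M_coeff_sum_M) (use assms coarsens_nonzero in auto)

lemma eta_in_QSym_deg:
  assumes "I \<in> vcomps l"
  shows "eta I \<in> QSym_deg l (sum_list I)"
  unfolding eta_def QSym_deg_def
  by (intro fs.span_sum fs.span_scale fs.span_base imageI)
    (use assms coarsens_vcomps coarsens_sum_list in auto)

lemma QSym_deg_subset: "QSym_deg l n \<subseteq> QSym l"
  unfolding QSym_deg_def QSym_def by (intro fs.span_mono) auto

lemma eta_in_QSym: "I \<in> vcomps l \<Longrightarrow> eta I \<in> QSym l"
  using eta_in_QSym_deg QSym_deg_subset by blast

lemma tensor_eta:
  "tensor (eta A) (eta B) =
    (\<Sum>(J1, J2)\<in>{J. J \<unlhd> A} \<times> {J. J \<unlhd> B}. scl (2 ^ length (J1 @ J2)) (tensor (M J1) (M J2)))"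
proof
  fix pq :: "xmonom \<times> xmonom"
  obtain p q where pq: "pq = (p, q)"
    by fastforce
  show "tensor (eta A) (eta B) pq =
    (\<Sum>(J1, J2)\<in>{J. J \<unlhd> A} \<times> {J. J \<unlhd> B}. scl (2 ^ length (J1 @ J2)) (tensor (M J1) (M J2))) pq"
    by (simp add: pq tensor_def eta_def sum_apply sum_product sum.cartesian_product scl_def
        case_prod_beta power_add algebra_simps)
qed

text \<open>Prefix sums grow strictly, so the degree of the left tensor factor reveals the cut.
  Hence no pair of coarsenings is counted for two cuts in \<open>coprod_eta\<close>.\<close>

lemma take_eq_if_sum_list_eq:
  fixes I :: vcomp
  assumes "0 \<notin> set I" "k \<le> length I" "k' \<le> length I"
    and "sum_list (take k I) = sum_list (take k' I)"
  shows "k = k'"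
proof -
  have less: False
    if "k < k'" "k' \<le> length I" "sum_list (take k I) = sum_list (take k' I)" for k k'
  proof -
    have "take k' I = take k I @ take (k' - k) (drop k I)"
      using that(1) by (metis le_add_diff_inverse less_imp_le take_add)
    then have "sum_list (take (k' - k) (drop k I)) = 0"
      using that(3) by simp
    moreover have "take (k' - k) (drop k I) \<noteq> []"
      using that by auto
    ultimately have "[0] \<unlhd> take (k' - k) (drop k I)"
      by (simp add: coarsens_total)
    then have "0 \<in> set (take (k' - k) (drop k I))"
      using coarsens_nonzero by fastforce
    with assms(1) show False
      using in_set_takeD in_set_dropD by fast
  qed
  show ?thesis
    using less[of k k'] less[of k' k] assms by (metis linorder_neqE_nat)
qed

text \<open>Cutting a coarsening of \<open>I\<close> amounts to cutting \<open>I\<close> and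
  coarsening both parts, and 2^len is multiplicative under concatenation.\<close>

lemma coprod_eta:
  assumes "I \<in> vcomps l"
  shows "coprod (eta I) = (\<Sum>k\<le>length I. tensor (eta (take k I)) (eta (drop k I)))"
proof -
  let ?C = "\<lambda>I. {J. J \<unlhd> I}"
  let ?X = "SIGMA k:{..length I}. ?C (take k I) \<times> ?C (drop k I)"
  let ?Y = "SIGMA J:?C I. {..length J}"
  let ?h = "\<lambda>(k :: nat, J1, J2). (J1 @ J2, length J1)"
  let ?g = "\<lambda>(J, j). scl (2 ^ length J) (tensor (M (take j J)) (M (drop j J)))"
  have nz: "0 \<notin> set I"
    using assms by (rule vcomps_nonzero)
  have bij: "bij_betw ?h ?X ?Y"
  proof (rule bij_betw_imageI)
    show "inj_on ?h ?X"
    proof (rule inj_onI)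
      fix x x' assume "x \<in> ?X" "x' \<in> ?X" and eq: "?h x = ?h x'"
      then obtain k J1 J2 k' J1' J2' where x: "x = (k, J1, J2)" "x' = (k', J1', J2')"
        and *: "k \<le> length I" "k' \<le> length I" "J1 \<unlhd> take k I" "J1' \<unlhd> take k' I"
        by auto
      have J: "J1 = J1'" "J2 = J2'"
        using eq x by auto
      have "k = k'"
        using coarsens_sum_list[OF *(3)] coarsens_sum_list[OF *(4)] J(1)
        by (intro take_eq_if_sum_list_eq[OF nz *(1,2)]) simp
      with x J show "x = x'"
        by simp
    qed
    show "?h ` ?X = ?Y"
    proof (intro equalityI subsetI)
      fix y assume "y \<in> ?h ` ?X"
      then obtain k J1 J2 where "y = (J1 @ J2, length J1)" "J1 \<unlhd> take k I" "J2 \<unlhd> drop k I"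
        by auto
      then show "y \<in> ?Y"
        using coarsens_append[of J1 "take k I" J2 "drop k I"] by simp
    next
      fix y assume "y \<in> ?Y"
      then obtain J j where y: "y = (J, j)" "J \<unlhd> I" "j \<le> length J"
        by auto
      then obtain k where "k \<le> length I" "take j J \<unlhd> take k I" "drop j J \<unlhd> drop k I"
        using coarsens_append_left[of "take j J" "drop j J" I] by auto
      with y show "y \<in> ?h ` ?X"
        by (intro image_eqI[of _ _ "(k, take j J, drop j J)"]) auto
    qed
  qed
  have "coprod (eta I) = (\<Sum>J\<in>?C I. scl (2 ^ length J) (coprod (M J)))"
    unfolding eta_def using assms coarsens_vcomps M_in_QSym by (intro coprod_sum[of _ _ l]) auto
  also have "\<dots> = (\<Sum>J\<in>?C I. \<Sum>j\<le>length J. ?g (J, j))"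
  proof (intro sum.cong refl)
    fix J assume "J \<in> ?C I"
    then have "0 \<notin> set J"
      using nz coarsens_nonzero by blast
    note J = coprod_M[OF this]
    show "scl (2 ^ length J) (coprod (M J)) = (\<Sum>j\<le>length J. ?g (J, j))"
      by (simp only: J fs.scale_sum_right prod.case)
  qed
  also have "\<dots> = (\<Sum>y\<in>?Y. ?g y)"
    by (subst sum.Sigma) (simp_all add: case_prod_beta)
  also have "\<dots> = (\<Sum>x\<in>?X. ?g (?h x))"
    by (rule sum.reindex_bij_betw[OF bij, symmetric])
  also have "\<dots> = (\<Sum>k\<le>length I. \<Sum>z\<in>?C (take k I) \<times> ?C (drop k I). ?g (?h (k, z)))"
    by (subst sum.Sigma) (simp_all add: case_prod_beta)
  also have "\<dots> = (\<Sum>k\<le>length I. tensor (eta (take k I)) (eta (drop k I)))"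
    by (simp add: tensor_eta case_prod_beta)
  finally show ?thesis .
qed

definition eta_span :: "nat \<Rightarrow> series set" where
  "eta_span l = fs.span (eta ` odd_vcomps l)"

lemma odd_vcomps_vcomps: "I \<in> odd_vcomps l \<Longrightarrow> I \<in> vcomps l"
  by (simp add: odd_vcomps_def)

lemma eta_span_subset_QSym: "eta_span l \<subseteq> QSym l"
  unfolding eta_span_def
  by (intro fs.span_minimal subspace_QSym) (auto intro: eta_in_QSym odd_vcomps_vcomps)

text \<open>Prefixes and suffixes of a composition with odd columns have odd columns, so
  \<open>coprod_eta\<close> does not leave the span.\<close>

lemma graded_subcoalgebra_eta_span: "graded_subcoalgebra l (eta_span l)"
  unfolding graded_subcoalgebra_def
proof (intro conjI)
  show sub: "fs.subspace (eta_span l)"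
    by (simp add: eta_span_def)
  show "eta_span l \<subseteq> QSym l"
    by (rule eta_span_subset_QSym)
  have eta: "eta I \<in> eta_span l" if "I \<in> odd_vcomps l" for I
    unfolding eta_span_def using that by (intro fs.span_base imageI)
  show "eta_span l = fs.span (\<Union>n. eta_span l \<inter> QSym_deg l n)"
  proof
    show "eta_span l \<subseteq> fs.span (\<Union>n. eta_span l \<inter> QSym_deg l n)"
    proof -
      have "eta I \<in> (\<Union>n. eta_span l \<inter> QSym_deg l n)" if "I \<in> odd_vcomps l" for I
        using eta[OF that] eta_in_QSym_deg[OF odd_vcomps_vcomps[OF that]] by blast
      then have "eta ` odd_vcomps l \<subseteq> (\<Union>n. eta_span l \<inter> QSym_deg l n)"
        by blast
      from fs.span_mono[OF this] show ?thesis
        by (simp only: eta_span_def)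
    qed
    show "fs.span (\<Union>n. eta_span l \<inter> QSym_deg l n) \<subseteq> eta_span l"
      by (intro fs.span_minimal sub) auto
  qed
  show "coprod ` eta_span l \<subseteq> tensor_square (eta_span l)"
  proof (intro subsetI, elim imageE)
    fix y h assume y: "y = coprod h" "h \<in> eta_span l"
    obtain F c where F: "finite F" "F \<subseteq> odd_vcomps l" "h = (\<Sum>I\<in>F. scl (c I) (eta I))"
      using y(2) unfolding eta_span_def by (rule span_image_explicit)
    have F_vcomps: "I \<in> vcomps l" if "I \<in> F" for I
      using that F(2) odd_vcomps_vcomps by blast
    have "y = (\<Sum>I\<in>F. scl (c I) (coprod (eta I)))"
      unfolding y(1) F(3) using F(1) eta_in_QSym F_vcomps by (intro coprod_sum[of _ _ l]) auto
    also have "\<dots> = (\<Sum>I\<in>F. scl (c I) (\<Sum>k\<le>length I. tensor (eta (take k I)) (eta (drop k I))))"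
    proof (intro sum.cong refl)
      fix I assume "I \<in> F"
      then show "scl (c I) (coprod (eta I)) =
          scl (c I) (\<Sum>k\<le>length I. tensor (eta (take k I)) (eta (drop k I)))"
        by (simp only: coprod_eta[OF F_vcomps])
    qed
    also have "\<dots> \<in> tensor_square (eta_span l)"
      unfolding tensor_square_def
    proof (intro fs.span_sum fs.span_scale fs.span_base)
      fix I k assume "I \<in> F"
      then have "I \<in> odd_vcomps l"
        using F(2) by blast
      then have "take k I \<in> odd_vcomps l" "drop k I \<in> odd_vcomps l"
        using vcomps_take_drop[of I l] in_set_takeD[of _ k I] in_set_dropD[of _ k I]
        unfolding odd_vcomps_def by blast+
      then show "tensor (eta (take k I)) (eta (drop k I)) \<in>
          {tensor f g |f g. f \<in> eta_span l \<and> g \<in> eta_span l}"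
        using eta by blast
    qed
    finally show "y \<in> tensor_square (eta_span l)" .
  qed
qed

section \<open>Agreement of the two functionals on the odd eta functions\<close>

lemma M_functional_eta:
  assumes "I \<in> vcomps l"
  shows "M_functional \<phi> (eta I) = (\<Sum>J | J \<unlhd> I. 2 ^ length J * \<phi> J)"
proof -
  have "M_functional \<phi> (eta I) = (\<Sum>J | J \<unlhd> I. 2 ^ length J * M_functional \<phi> (M J))"
    unfolding eta_def using assms coarsens_vcomps M_in_QSym
    by (intro linear_on_QSym_sum[OF linear_M_functional[of l]]) auto
  also have "\<dots> = (\<Sum>J | J \<unlhd> I. 2 ^ length J * \<phi> J)"
    using coarsens_nonzero vcomps_nonzero[OF assms]
    by (intro sum.cong refl) (auto simp: M_functional_M)
  finally show ?thesis .
qed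

lemma odd_wt_sum_list: "\<forall>i\<in>set I. odd (wt i) \<Longrightarrow> odd (wt (sum_list I)) \<longleftrightarrow> odd (length I)"
  by (induction I) auto

text \<open>For nonempty \<open>I\<close>, one side sees only the coarsening
  \<open>[sum_list I]\<close>, the other is \<open>sum_coarsens\<close>. Weight and length have the
  same parity since all columns are odd.\<close>

lemma zetaQ_bar_eta:
  assumes "I \<in> odd_vcomps l"
  shows "zetaQ_bar (eta I) = zetaQ_inv l (eta I)"
proof -
  have I: "I \<in> vcomps l" "0 \<notin> set I"
    using assms odd_vcomps_vcomps vcomps_nonzero by blast+
  have bar: "zetaQ_bar (eta I) =
      (\<Sum>J | J \<unlhd> I. 2 ^ length J * (if length J \<le> 1 then (- 1) ^ wt (sum_list J) else 0))"
    using zetaQ_bar_eq[OF eta_in_QSym] M_functional_eta I(1) by simp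
  have inv: "zetaQ_inv l (eta I) = (\<Sum>J | J \<unlhd> I. (- 2) ^ length J)"
    using zetaQ_inv_eq[OF eta_in_QSym] M_functional_eta I(1)
    by (simp flip: power_mult_distrib)
  show ?thesis
  proof (cases "I = []")
    case True
    then show ?thesis
      using bar inv by simp
  next
    case False
    have "zetaQ_bar (eta I) = (\<Sum>J | J \<unlhd> I. if J = [sum_list I] then 2 * (- 1) ^ wt (sum_list I) else 0)"
      unfolding bar
    proof (intro sum.cong refl)
      fix J assume J: "J \<in> {J. J \<unlhd> I}"
      then have "J \<noteq> []" "sum_list J = sum_list I"
        using False coarsens_sum_list by auto
      then show "2 ^ length J * (if length J \<le> 1 then (- 1) ^ wt (sum_list J) else 0) =
          (if J = [sum_list I] then 2 * (- 1) ^ wt (sum_list I) else (0 :: rat))"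
        by (cases J) auto
    qed
    also have "\<dots> = 2 * (- 1) ^ wt (sum_list I)"
      using False by (simp add: coarsens_total)
    also have "(- 1 :: rat) ^ wt (sum_list I) = (- 1) ^ length I"
      using odd_wt_sum_list[of I] assms by (auto simp: odd_vcomps_def minus_one_power_iff)
    finally show ?thesis
      using sum_coarsens[OF I(2) False] inv by simp
  qed
qed

lemma zetaQ_bar_eta_span:
  assumes "h \<in> eta_span l"
  shows "zetaQ_bar h = zetaQ_inv l h"
proof -
  let ?bar = "M_functional (\<lambda>I. if length I \<le> 1 then (- 1) ^ wt (sum_list I) else 0)"
  let ?inv = "M_functional (\<lambda>I. (- 1) ^ length I)"
  obtain F c where F: "finite F" "F \<subseteq> odd_vcomps l" "h = (\<Sum>I\<in>F. scl (c I) (eta I))"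
    using assms unfolding eta_span_def by (rule span_image_explicit)
  have F_QSym: "eta I \<in> QSym l" if "I \<in> F" for I
    using that F(2) odd_vcomps_vcomps eta_in_QSym by blast
  have "?bar h = (\<Sum>I\<in>F. c I * ?bar (eta I))"
    unfolding F(3) by (rule linear_on_QSym_sum[OF linear_M_functional F(1) F_QSym])
  also have "\<dots> = (\<Sum>I\<in>F. c I * ?inv (eta I))"
  proof (intro sum.cong refl)
    fix I assume I: "I \<in> F"
    then show "c I * ?bar (eta I) = c I * ?inv (eta I)"
      using zetaQ_bar_eta[of I l] F(2)
      unfolding zetaQ_bar_eq[OF F_QSym[OF I]] zetaQ_inv_eq[OF F_QSym[OF I]] by auto
  qed
  also have "\<dots> = ?inv h"
    unfolding F(3) by (rule linear_on_QSym_sum[OF linear_M_functional F(1) F_QSym, symmetric])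
  finally show ?thesis
    using assms eta_span_subset_QSym zetaQ_bar_eq[of h l] zetaQ_inv_eq[of h l] by (simp add: subset_iff)
qed

section \<open>Maximality\<close>

text \<open>Each such \<open>J\<close> coarsens \<open>E\<close> of its coloring word, and that word
  has length \<open>wt m\<close> and letters among the colors of \<open>m\<close>.\<close>

lemma finite_vcomps_sum: "finite {J :: vcomp. 0 \<notin> set J \<and> sum_list J = m}"
proof (rule finite_subset)
  let ?U = "{u. set u \<subseteq> Poly_Mapping.keys m \<and> length u = wt m}"
  show "{J :: vcomp. 0 \<notin> set J \<and> sum_list J = m} \<subseteq> (\<Union>u\<in>?U. {J. J \<unlhd> E u})"
  proof
    fix J :: vcomp assume "J \<in> {J. 0 \<notin> set J \<and> sum_list J = m}"
    then have J: "0 \<notin> set J" "sum_list J = m"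
      by auto
    have "[] \<notin> set (map column_word J)"
    proof
      assume "[] \<in> set (map column_word J)"
      then obtain j where "j \<in> set J" "column_word j = []"
        by auto
      then have "j = 0"
        using word_vec_column_word[of j] by simp
      with J(1) \<open>j \<in> set J\<close> show False
        by simp
    qed
    then have "map word_vec (map column_word J) \<unlhd> E (concat (map column_word J))"
      by (rule coarsens_E_intro)
    then have "J \<unlhd> E (cw J)"
      by (simp only: map_word_vec_column_word cw_eq)
    moreover have "length (cw J) = wt m"
      using J(2) by (auto simp: length_cw wt_sum_list)
    moreover have "set (cw J) \<subseteq> Poly_Mapping.keys m"
      using J(2) by (auto simp: cw_eq set_column_word keys_sum_list)
    ultimately show "J \<in> (\<Union>u\<in>?U. {J. J \<unlhd> E u})"
      by blast
  qed
  show "finite (\<Union>u\<in>?U. {J. J \<unlhd> E u})"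
    by (intro finite_UN_I finite_lists_length_eq finite_keys finite_coarsens)
qed

text \<open>A form of the generalized Dehn-Sommerville relations for colored compositions. The sum
  contains the term of \<open>[m]\<close> with sign -1: for odd \<open>wt m\<close> it cancels
  against the right side, for even \<open>wt m\<close> the two combine to twice the
  coefficient.\<close>

definition odd_relations :: "series \<Rightarrow> bool" where
  "odd_relations h \<longleftrightarrow> (\<forall>A B m. 0 \<notin> set A \<longrightarrow> 0 \<notin> set B \<longrightarrow> m \<noteq> 0 \<longrightarrow>
     (\<Sum>J | 0 \<notin> set J \<and> sum_list J = m. (- 1) ^ length J * M_coeff h (A @ J @ B)) =
     (- 1) ^ wt m * M_coeff h (A @ [m] @ B))"

lemma odd_relations_subspace: "fs.subspace {h. odd_relations h}"
proof (rule fs.subspaceI)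
  show "0 \<in> {h. odd_relations h}"
    by (simp add: odd_relations_def del: append_assoc)
next
  fix f g assume f: "f \<in> {h. odd_relations h}" and g: "g \<in> {h. odd_relations h}"
  show "f + g \<in> {h. odd_relations h}"
    unfolding odd_relations_def mem_Collect_eq M_coeff_add distrib_left sum.distrib
    using f g unfolding odd_relations_def mem_Collect_eq by simp
next
  fix c :: rat and f assume f: "f \<in> {h. odd_relations h}"
  show "scl c f \<in> {h. odd_relations h}"
    unfolding odd_relations_def mem_Collect_eq M_coeff_scl mult.left_commute[of _ c]
      sum_distrib_left[symmetric]
    using f unfolding odd_relations_def mem_Collect_eq by simp
qed

text \<open>Contracting the coproduct with coordinate functionals on both sides.\<close>

lemma subcoalgebra_quotient:
  assumes "graded_subcoalgebra l C" "h \<in> C" "0 \<notin> set A" "0 \<notin> set B"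
  obtains g where "g \<in> C" "\<And>J. 0 \<notin> set J \<Longrightarrow> M_coeff g J = M_coeff h (A @ J @ B)"
proof -
  have C: "fs.subspace C" "C \<subseteq> QSym l" "\<And>h. h \<in> C \<Longrightarrow> coprod h \<in> tensor_square C"
    using assms(1) unfolding graded_subcoalgebra_def by blast+
  have left: "(\<lambda>q. t (p, q)) \<in> C" and right: "(\<lambda>q. t (q, p)) \<in> C"
    if "t \<in> tensor_square C" for t and p :: xmonom
  proof -
    \<comment> \<open>Evaluating one set of variables at the monomial \<open>p\<close> sends a
      tensor of \<open>f\<close> and \<open>g\<close> to a multiple of the other factor, so slices
      of \<open>tensor_square C\<close> lie in \<open>C\<close>.\<close>
    have sp: "fs.subspace {t. (\<lambda>q. t (p, q)) \<in> C \<and> (\<lambda>q. t (q, p)) \<in> C}"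
    proof (rule fs.subspaceI)
      show "0 \<in> {t. (\<lambda>q. t (p, q)) \<in> C \<and> (\<lambda>q. t (q, p)) \<in> C}"
        using fs.subspace_0[OF C(1)] by (simp add: zero_fun_def)
    next
      fix s t assume "s \<in> {t. (\<lambda>q. t (p, q)) \<in> C \<and> (\<lambda>q. t (q, p)) \<in> C}"
        "t \<in> {t. (\<lambda>q. t (p, q)) \<in> C \<and> (\<lambda>q. t (q, p)) \<in> C}"
      then show "s + t \<in> {t. (\<lambda>q. t (p, q)) \<in> C \<and> (\<lambda>q. t (q, p)) \<in> C}"
        using fs.subspace_add[OF C(1), of "\<lambda>q. s (p, q)" "\<lambda>q. t (p, q)"]
          fs.subspace_add[OF C(1), of "\<lambda>q. s (q, p)" "\<lambda>q. t (q, p)"]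
        by (simp add: plus_fun_def)
    next
      fix c t assume "t \<in> {t. (\<lambda>q. t (p, q)) \<in> C \<and> (\<lambda>q. t (q, p)) \<in> C}"
      then show "scl c t \<in> {t. (\<lambda>q. t (p, q)) \<in> C \<and> (\<lambda>q. t (q, p)) \<in> C}"
        using fs.subspace_scale[OF C(1), of "\<lambda>q. t (p, q)" c]
          fs.subspace_scale[OF C(1), of "\<lambda>q. t (q, p)" c]
        by (simp add: scl_def)
    qed
    have "{tensor f g |f g. f \<in> C \<and> g \<in> C} \<subseteq> {t. (\<lambda>q. t (p, q)) \<in> C \<and> (\<lambda>q. t (q, p)) \<in> C}"
    proof (intro subsetI, elim CollectE exE conjE)
      fix t f g assume t: "t = tensor f g" "f \<in> C" "g \<in> C"
      then have "scl (f p) g \<in> C" "scl (g p) f \<in> C"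
        using fs.subspace_scale[OF C(1)] by blast+
      then show "t \<in> {t. (\<lambda>q. t (p, q)) \<in> C \<and> (\<lambda>q. t (q, p)) \<in> C}"
        by (simp add: t(1) tensor_def scl_def mult.commute)
    qed
    from fs.span_minimal[OF this sp] show "(\<lambda>q. t (p, q)) \<in> C" "(\<lambda>q. t (q, p)) \<in> C"
      using that unfolding tensor_square_def by blast+
  qed
  \<comment> \<open>First the prefix \<open>A\<close> is stripped, then the suffix \<open>B\<close>;
    the second slice is possible because \<open>f\<close> is in \<open>C\<close> again.\<close>
  define f where "f = (\<lambda>q. coprod h (xmono [0..<length A] A, q))"
  define g where "g = (\<lambda>q. coprod f (q, xmono [0..<length B] B))"
  have f: "f \<in> C"
    unfolding f_def using left C(3) assms(2) by blast
  then have g: "g \<in> C"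
    unfolding g_def using right C(3) by blast
  have "M_coeff f J = M_coeff h (A @ J)" if "0 \<notin> set J" for J
    using coprod_coeff[of h l A J] that assms C(2) by (auto simp: f_def M_coeff_def)
  moreover have "M_coeff g J = M_coeff f (J @ B)" if "0 \<notin> set J" for J
    using coprod_coeff[of f l J B] that assms C(2) f by (auto simp: g_def M_coeff_def)
  ultimately have "M_coeff g J = M_coeff h (A @ J @ B)" if "0 \<notin> set J" for J
    using that assms(4) by simp
  with g that show ?thesis
    by blast
qed

text \<open>The equality of functionals at the contraction \<open>g\<close> sums over all degrees of
  \<open>g\<close>. If \<open>f\<close> is homogeneous only one degree occurs; since the relations
  are linear and \<open>C\<close> is spanned by homogeneous elements, these suffice.\<close>

lemma subcoalgebra_odd_relations:
  assumes "graded_subcoalgebra l C" "\<forall>h\<in>C. zetaQ_bar h = zetaQ_inv l h" "h \<in> C"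
  shows "odd_relations h"
proof -
  have C: "C \<subseteq> QSym l" "C = fs.span (\<Union>n. C \<inter> QSym_deg l n)"
    using assms(1) unfolding graded_subcoalgebra_def by blast+
  have hom: "odd_relations f" if f: "f \<in> C" "f \<in> QSym_deg l n" for f n
    unfolding odd_relations_def
  proof (intro allI impI)
    fix A B :: vcomp and m :: cvec assume A: "0 \<notin> set A" and B: "0 \<notin> set B" and m: "m \<noteq> 0"
    let ?F = "{J :: vcomp. 0 \<notin> set J \<and> sum_list J = m}"
    obtain g where g: "g \<in> C" "\<And>J. 0 \<notin> set J \<Longrightarrow> M_coeff g J = M_coeff f (A @ J @ B)"
      using subcoalgebra_quotient[OF assms(1) f(1) A B] by blast
    have deg: "sum_list A + sum_list J + sum_list B = n"
      if "0 \<notin> set J" "M_coeff f (A @ J @ B) \<noteq> 0" for J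
    proof -
      have "M_supp f \<subseteq> {I \<in> vcomps l. sum_list I = n}"
        using f(2) vcomps_nonzero unfolding QSym_deg_def by (intro span_M(2)) auto
      moreover have "A @ J @ B \<in> M_supp f"
        using that A B by (simp add: M_supp_def)
      ultimately show ?thesis
        by (auto simp: add.assoc)
    qed
    show "(\<Sum>J\<in>?F. (- 1) ^ length J * M_coeff f (A @ J @ B)) = (- 1) ^ wt m * M_coeff f (A @ [m] @ B)"
    proof (cases "sum_list A + m + sum_list B = n")
      case True
      have supp: "M_supp g \<subseteq> ?F"
      proof
        fix J assume J: "J \<in> M_supp g"
        then have "0 \<notin> set J" "M_coeff f (A @ J @ B) \<noteq> 0"
          using g(2)[of J] by (auto simp: M_supp_def)
        then show "J \<in> ?F"
          using deg[of J] True by (metis (mono_tags, lifting) add_left_cancel add_right_cancel mem_Collect_eq)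
      qed
      have sum: "M_functional \<phi> g = (\<Sum>J\<in>?F. M_coeff f (A @ J @ B) * \<phi> J)" for \<phi>
        using M_functional_superset[OF finite_vcomps_sum supp] g(2) by simp
      have "zetaQ_bar g = zetaQ_inv l g" "g \<in> QSym l"
        using assms(2) g(1) C(1) by blast+
      then have "(\<Sum>J\<in>?F. M_coeff f (A @ J @ B) * (- 1) ^ length J) =
          (\<Sum>J\<in>?F. M_coeff f (A @ J @ B) * (if length J \<le> 1 then (- 1) ^ wt (sum_list J) else 0))"
        using zetaQ_bar_eq[of g l] zetaQ_inv_eq[of g l] unfolding sum by simp
      also have "\<dots> = (\<Sum>J\<in>?F. if J = [m] then M_coeff f (A @ [m] @ B) * (- 1) ^ wt m else 0)"
      proof (intro sum.cong refl)
        fix J assume "J \<in> ?F"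
        then show "M_coeff f (A @ J @ B) * (if length J \<le> 1 then (- 1) ^ wt (sum_list J) else 0) =
            (if J = [m] then M_coeff f (A @ [m] @ B) * (- 1) ^ wt m else 0)"
          using m by (cases J) auto
      qed
      also have "\<dots> = M_coeff f (A @ [m] @ B) * (- 1) ^ wt m"
        using m by (simp add: finite_vcomps_sum)
      finally show ?thesis
        by (simp add: mult.commute)
    next
      case False
      then have "M_coeff f (A @ J @ B) = 0" if "J \<in> ?F" for J
        using deg[of J] that by auto
      moreover have "M_coeff f (A @ [m] @ B) = 0"
        using deg[of "[m]"] False m by auto
      ultimately show ?thesis
        by simp
    qed
  qed
  have "fs.span (\<Union>n. C \<inter> QSym_deg l n) \<subseteq> {h. odd_relations h}"
    using hom by (intro fs.span_minimal odd_relations_subspace) auto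
  with C(2) assms(3) show ?thesis
    by blast
qed

lemma length_le_wt: "0 \<notin> set J \<Longrightarrow> length J \<le> wt (sum_list J)"
proof (induction J)
  case (Cons j J)
  then show ?case
    using wt_pos[of j] by auto
qed simp

text \<open>For \<open>m\<close> of even weight the relation expresses \<open>2 h(A m B)\<close> by values of \<open>h\<close> at
  compositions with more columns.\<close>

lemma odd_relations_eq_0:
  assumes "odd_relations h" "\<And>J. 0 \<notin> set J \<Longrightarrow> \<forall>j\<in>set J. odd (wt j) \<Longrightarrow> M_coeff h J = 0"
    and "0 \<notin> set I"
  shows "M_coeff h I = 0"
  using assms(3)
\<comment> \<open>The weight stays fixed while the number of columns grows, up to the bound of
  \<open>length_le_wt\<close>.\<close>
proof (induction "wt (sum_list I) - length I" arbitrary: I rule: less_induct)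
  case less
  show ?case
  proof (cases "\<forall>j\<in>set I. odd (wt j)")
    case True
    then show ?thesis
      using assms(2) less.prems by blast
  next
    case False
    then obtain m where m: "m \<in> set I" "even (wt m)"
      by blast
    then obtain A B where "I = A @ m # B"
      using split_list by metis
    then have I: "I = A @ [m] @ B"
      by simp
    have AB: "0 \<notin> set A" "0 \<notin> set B" "m \<noteq> 0"
      using less.prems I by auto
    let ?F = "{J :: vcomp. 0 \<notin> set J \<and> sum_list J = m}"
    have "M_coeff h (A @ J @ B) = 0" if "J \<in> ?F" "J \<noteq> [m]" for J
    proof -
      have "length J > 1"
        using that AB(3) by (cases J rule: remdups_adj.cases) auto
      moreover have "wt (sum_list (A @ J @ B)) = wt (sum_list I)"
        using that I by simp
      moreover have "0 \<notin> set (A @ J @ B)"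
        using that AB by simp
      \<comment> \<open>The measure is a truncated difference; this bound ensures that it really
        decreases.\<close>
      moreover have "length (A @ J @ B) \<le> wt (sum_list (A @ J @ B))"
        using calculation(3) by (rule length_le_wt)
      ultimately show ?thesis
        unfolding I by (intro less.hyps) (simp_all add: I)
    qed
    then have "(\<Sum>J\<in>?F. (- 1) ^ length J * M_coeff h (A @ J @ B)) =
        (\<Sum>J\<in>?F. if J = [m] then - M_coeff h I else 0)"
      using I by (intro sum.cong) auto
    also have "\<dots> = - M_coeff h I"
      using AB(3) by (simp add: finite_vcomps_sum)
    finally have "- M_coeff h I = (- 1) ^ wt m * M_coeff h (A @ [m] @ B)"
      using assms(1)[unfolded odd_relations_def, rule_format, OF AB] by simp
    then show ?thesis
      using m(2) I by simp
  qed
qed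

text \<open>\<open>k\<close> bounds the lengths of the odd compositions in the support. Subtracting
  multiples of \<open>eta\<close> at those of maximal length keeps the relations and lowers the
  bound; once no odd composition is left, \<open>odd_relations_eq_0\<close> applies.\<close>

lemma odd_relations_in_eta_span:
  assumes "h \<in> QSym l" "odd_relations h"
  shows "h \<in> eta_span l"
proof -
  have *: "h \<in> eta_span l" if "h \<in> QSym l" "odd_relations h"
    "\<And>J. J \<in> M_supp h \<Longrightarrow> \<forall>j\<in>set J. odd (wt j) \<Longrightarrow> length J < k" for h k
    using that
  proof (induction k arbitrary: h)
    case 0
    then have "M_coeff h J = 0" if "0 \<notin> set J" "\<forall>j\<in>set J. odd (wt j)" for J
      using that unfolding M_supp_def by blast
    note odd_relations_eq_0[OF "0.prems"(2) this]
    then have "h = 0"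
      by (rule QSym_eq_0[OF "0.prems"(1)])
    then show ?case
      by (simp only: eta_span_def fs.span_zero)
  next
    case (Suc k)
    note supp = QSym_M_supp[OF Suc.prems(1)]
    define X where "X = {J \<in> M_supp h. (\<forall>j\<in>set J. odd (wt j)) \<and> length J = k}"
    have X: "finite X" "X \<subseteq> odd_vcomps l"
      using supp(1,2) by (auto simp: X_def odd_vcomps_def)
    \<comment> \<open>\<open>eta J\<close> has coefficient 2^k at its own index \<open>J\<close>,
      and no other member of \<open>X\<close> contributes there.\<close>
    define s where "s = (\<Sum>J\<in>X. scl (M_coeff h J / 2 ^ k) (eta J))"
    have s: "s \<in> eta_span l"
      unfolding s_def eta_span_def using X(2) by (intro fs.span_sum fs.span_scale fs.span_base) auto
    have "odd_relations s"
      using subcoalgebra_odd_relations[OF graded_subcoalgebra_eta_span] zetaQ_bar_eta_span s by blast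
    then have rel: "odd_relations (h - s)"
      using fs.subspace_diff[OF odd_relations_subspace, of h s] Suc.prems(2) by simp
    have QSym: "h - s \<in> QSym l"
      using fs.subspace_diff[OF subspace_QSym Suc.prems(1)] s eta_span_subset_QSym by blast
    have "length J < k" if J: "J \<in> M_supp (h - s)" "\<forall>j\<in>set J. odd (wt j)" for J
    proof (rule ccontr)
      assume len: "\<not> length J < k"
      have J0: "0 \<notin> set J"
        using J(1) by (auto simp: M_supp_def)
      have "M_coeff s J = (\<Sum>K\<in>X. if K = J then M_coeff h J else 0)"
        unfolding s_def M_coeff_sum
      proof (intro sum.cong refl)
        fix K assume K: "K \<in> X"
        then have K0: "0 \<notin> set K" "length K = k"
          by (auto simp: X_def M_supp_def)
        have "J \<unlhd> K \<longleftrightarrow> K = J"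
          using coarsens_same_length[of J K] coarsens_length[of J K] K0(2) len coarsens_refl by auto
        then show "M_coeff (scl (M_coeff h K / 2 ^ k) (eta K)) J = (if K = J then M_coeff h J else 0)"
          using K0 J0 by (auto simp: M_coeff_eta)
      qed
      then have s_J: "M_coeff s J = (if J \<in> X then M_coeff h J else 0)"
        using X(1) by simp
      have "M_coeff h J = 0" if "J \<notin> X"
        using that Suc.prems(3)[of J] J(2) J0 len by (auto simp: X_def M_supp_def less_Suc_eq)
      with s_J have "M_coeff (h - s) J = 0"
        by auto
      with J(1) show False
        by (simp add: M_supp_def)
    qed
    then have "h - s \<in> eta_span l"
      using Suc.IH QSym rel by blast
    from fs.span_add[OF this[unfolded eta_span_def] s[unfolded eta_span_def]] show ?case
      by (simp only: diff_add_cancel eta_span_def)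
  qed
  have "length J < Suc (Max (length ` M_supp h))" if "J \<in> M_supp h" for J
    using that QSym_M_supp(1)[OF assms(1)] by (simp add: less_Suc_eq_le)
  with * assms show ?thesis
    by metis
qed

lemma O_infty_eq: "O_infty l = eta_span l"
  unfolding O_infty_def
proof (rule Greatest_equality)
  show "graded_subcoalgebra l (eta_span l) \<and> (\<forall>h\<in>eta_span l. zetaQ_bar h = zetaQ_inv l h)"
    using graded_subcoalgebra_eta_span zetaQ_bar_eta_span by blast
next
  fix C assume C: "graded_subcoalgebra l C \<and> (\<forall>h\<in>C. zetaQ_bar h = zetaQ_inv l h)"
  then have "C \<subseteq> QSym l"
    by (simp add: graded_subcoalgebra_def)
  with C show "C \<subseteq> eta_span l"
    using subcoalgebra_odd_relations odd_relations_in_eta_span by blast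
qed

section \<open>The basis theorem\<close>

text \<open>Independence of the image set alone would not notice repeated members of the family;
  injectivity is therefore obtained along with it.\<close>

lemma independent_family:
  assumes "\<And>F c. finite F \<Longrightarrow> F \<subseteq> A \<Longrightarrow> (\<Sum>a\<in>F. scl (c a) (f a)) = 0 \<Longrightarrow> \<forall>a\<in>F. c a = 0"
  shows "inj_on f A" "fs.independent (f ` A)"
proof -
  show "inj_on f A"
  proof (rule inj_onI, rule ccontr)
    fix a b assume ab: "a \<in> A" "b \<in> A" "f a = f b" "a \<noteq> b"
    \<comment> \<open>The coefficients of the relation \<open>f a - f b = 0\<close> that a
      repetition would give.\<close>
    let ?c = "\<lambda>x. if x = a then 1 else - 1 :: rat"
    have "(\<Sum>x\<in>{a, b}. scl (?c x) (f x)) = scl 1 (f a) + scl (- 1) (f a)"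
      using ab(3,4) by (subst sum.insert) (simp_all del: fs.scale_minus_left)
    also have "\<dots> = 0"
      unfolding fs.scale_left_distrib[symmetric] by (simp only: right_minus fs.scale_zero_left)
    finally have "\<forall>x\<in>{a, b}. ?c x = 0"
      using ab by (intro assms) auto
    then show False
      by simp
  qed
  show "fs.independent (f ` A)"
    unfolding fs.dependent_explicit
  proof (intro notI, elim exE conjE bexE)
    fix S u v
    assume S: "finite S" "S \<subseteq> f ` A" "v \<in> S" "u v \<noteq> 0" "(\<Sum>v\<in>S. scl (u v) v) = 0"
    then obtain F where F: "F \<subseteq> A" "inj_on f F" "S = f ` F"
      by (meson subset_image_inj)
    have "finite F"
      using S(1) F(2,3) finite_image_iff by blast
    moreover have "(\<Sum>a\<in>F. scl (u (f a)) (f a)) = 0"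
      using S(5) unfolding F(3) sum.reindex[OF F(2)] comp_def .
    ultimately have "\<forall>a\<in>F. u (f a) = 0"
      using F(1) by (intro assms)
    with S(3,4) F(3) show False
      by blast
  qed
qed

lemma obtain_maximal:
  fixes m :: "'a \<Rightarrow> nat"
  assumes "finite F" "x \<in> F" "P x"
  obtains y where "y \<in> F" "P y" "\<And>z. z \<in> F \<Longrightarrow> P z \<Longrightarrow> m z \<le> m y"
proof -
  let ?G = "{x \<in> F. P x}"
  have "finite (m ` ?G)" "m ` ?G \<noteq> {}"
    using assms by auto
  then have "Max (m ` ?G) \<in> m ` ?G"
    by (rule Max_in)
  then obtain y where "y \<in> ?G" "m y = Max (m ` ?G)"
    by force
  with that \<open>finite (m ` ?G)\<close> show ?thesis
    by (metis (mono_tags, lifting) Max_ge imageI mem_Collect_eq)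
qed

text \<open>Take a longest \<open>I\<close> with nonzero coefficient: among the members involved,
  only \<open>eta I\<close> contains \<open>M I\<close>.\<close>

lemma eta_independent: "inj_on eta (odd_vcomps l)" "fs.independent (eta ` odd_vcomps l)"
proof -
  have *: "\<forall>I\<in>F. c I = 0"
    if F: "finite F" "F \<subseteq> odd_vcomps l" "(\<Sum>I\<in>F. scl (c I) (eta I)) = 0" for F c
  proof (rule ccontr)
    assume "\<not> (\<forall>I\<in>F. c I = 0)"
    then obtain I where I: "I \<in> F" "c I \<noteq> 0" and
      max: "\<And>J. J \<in> F \<Longrightarrow> c J \<noteq> 0 \<Longrightarrow> length J \<le> length I"
      using obtain_maximal[OF F(1), of _ "\<lambda>I. c I \<noteq> 0" length] by metis
    have nz: "0 \<notin> set J" if "J \<in> F" for J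
      using that F(2) odd_vcomps_vcomps vcomps_nonzero by blast
    have "0 = M_coeff (\<Sum>J\<in>F. scl (c J) (eta J)) I"
      unfolding F(3) by (rule M_coeff_zero[symmetric])
    also have "\<dots> = (\<Sum>J\<in>F. if J = I then c I * 2 ^ length I else 0)"
      unfolding M_coeff_sum
    proof (intro sum.cong refl)
      fix J assume J: "J \<in> F"
      show "M_coeff (scl (c J) (eta J)) I = (if J = I then c I * 2 ^ length I else 0)"
      proof (cases "c J = 0")
        case False
        then have "I \<unlhd> J \<longleftrightarrow> J = I"
          using max[OF J] coarsens_length[of I J] coarsens_same_length[of I J] coarsens_refl by auto
        then show ?thesis
          using nz J I(1) by (auto simp: M_coeff_eta)
      qed (use I(2) in auto)
    qed
    also have "\<dots> = c I * 2 ^ length I"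
      using F(1) I(1) by simp
    finally show False
      using I(2) by simp
  qed
  show "inj_on eta (odd_vcomps l)" "fs.independent (eta ` odd_vcomps l)"
    by (rule independent_family[OF *]; assumption)+
qed

section \<open>From the eta basis to the theta basis\<close>

lemma theta_in_eta_span:
  assumes "(S, u) \<in> admissible l"
  shows "theta S u \<in> eta_span l"
  unfolding theta_eq_sum_eta[OF assms] eta_span_def
proof (intro fs.span_sum fs.span_scale fs.span_base imageI)
  fix T assume "T \<in> Pow S"
  then show "odd_comp (peak_comp T u) \<in> odd_vcomps l"
    using admissible_odd_vcomps(1) admissible_subset[OF assms] by blast
qed

text \<open>Different admissible pairs give different odd compositions, so the signs in
  \<open>theta_eq_sum_eta\<close> are coordinates, triangular for inclusion of peak sets within each
  word.\<close>

lemma representation_theta: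
  assumes "(S, u) \<in> admissible l" "(T, v) \<in> admissible l"
  shows "fs.representation (eta ` odd_vcomps l) (theta S u) (eta (odd_comp (peak_comp T v))) =
    (if T \<subseteq> S \<and> u = v then (- 1) ^ card T else 0)"
proof -
  let ?B = "eta ` odd_vcomps l" and ?K = "\<lambda>T u. odd_comp (peak_comp T u)"
  let ?r = "\<lambda>h. fs.representation ?B h (eta (?K T v))"
  note ind = eta_independent(2)[of l]
  have finS: "finite S"
    using admissible_odd_vcomps(3)[OF assms(1)] finite_Pk by metis
  have adm: "(R, u) \<in> admissible l" if "R \<subseteq> S" for R
    using admissible_subset[OF assms(1) that] .
  have eta: "eta (?K R u) \<in> ?B" if "R \<subseteq> S" for R
    using admissible_odd_vcomps(1)[OF adm[OF that]] by blast
  have eq: "eta (?K T v) = eta (?K R u) \<longleftrightarrow> R = T \<and> u = v" if "R \<subseteq> S" for R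
  proof -
    have "eta (?K T v) = eta (?K R u) \<longleftrightarrow> ?K T v = ?K R u"
      by (rule inj_on_eq_iff[OF eta_independent(1) admissible_odd_vcomps(1)[OF assms(2)]
            admissible_odd_vcomps(1)[OF adm[OF that]]])
    then show ?thesis
      using admissible_odd_vcomps(2,3)[OF adm[OF that]] admissible_odd_vcomps(2,3)[OF assms(2)]
      by metis
  qed
  have "?r (theta S u) = (\<Sum>R\<in>Pow S. ?r (scl ((- 1) ^ card R) (eta (?K R u))))"
  proof -
    have "fs.representation ?B (theta S u) =
        (\<lambda>b. \<Sum>R\<in>Pow S. fs.representation ?B (scl ((- 1) ^ card R) (eta (?K R u))) b)"
      unfolding theta_eq_sum_eta[OF assms(1)]
      by (rule fs.representation_sum[OF ind]) (rule fs.span_scale, rule fs.span_base, rule eta, simp)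
    then show ?thesis
      by (rule fun_cong)
  qed
  also have "\<dots> = (\<Sum>R\<in>Pow S. if R = T then (if u = v then (- 1) ^ card T else 0) else 0)"
  proof (intro sum.cong refl)
    fix R assume "R \<in> Pow S"
    then have R: "R \<subseteq> S"
      by simp
    have "?r (scl ((- 1) ^ card R) (eta (?K R u))) = (- 1) ^ card R * ?r (eta (?K R u))"
      by (subst fs.representation_scale[OF ind fs.span_base[OF eta[OF R]]]) simp
    then show "?r (scl ((- 1) ^ card R) (eta (?K R u))) =
        (if R = T then (if u = v then (- 1) ^ card T else 0) else 0)"
      using eq[OF R] by (simp add: fs.representation_basis[OF ind eta[OF R]])
  qed
  also have "\<dots> = (if T \<subseteq> S \<and> u = v then (- 1) ^ card T else 0)"
    using finS by simp
  finally show ?thesis .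
qed

text \<open>Among the nonzero coefficients take a pair (T, v) with the largest peak set: its
  \<open>eta\<close> occurs in \<open>theta S u\<close> only if T is contained in S and u = v, and
  maximality then forces S = T.\<close>

lemma theta_independent:
  "inj_on (\<lambda>(S, u). theta S u) (admissible l)"
  "fs.independent ((\<lambda>(S, u). theta S u) ` admissible l)"
proof -
  let ?\<theta> = "\<lambda>(S, u). theta S u"
  have *: "\<forall>x\<in>F. c x = 0"
    if F: "finite F" "F \<subseteq> admissible l" "(\<Sum>x\<in>F. scl (c x) (?\<theta> x)) = 0" for F c
  proof (rule ccontr)
    assume "\<not> (\<forall>x\<in>F. c x = 0)"
    then obtain y where y: "y \<in> F" "c y \<noteq> 0" and
      max: "\<And>x. x \<in> F \<Longrightarrow> c x \<noteq> 0 \<Longrightarrow> card (fst x) \<le> card (fst y)"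
      using obtain_maximal[OF F(1), of _ "\<lambda>x. c x \<noteq> 0" "\<lambda>x. card (fst x)"] by metis
    obtain T v where Tv: "y = (T, v)"
      by fastforce
    let ?r = "\<lambda>h. fs.representation (eta ` odd_vcomps l) h (eta (odd_comp (peak_comp T v)))"
    note ind = eta_independent(2)[of l]
    have adm: "(T, v) \<in> admissible l"
      using y(1) F(2) Tv by blast
    have span: "?\<theta> x \<in> fs.span (eta ` odd_vcomps l)" if "x \<in> F" for x
      using that F(2) theta_in_eta_span unfolding eta_span_def by (cases x) auto
    have "0 = ?r (\<Sum>x\<in>F. scl (c x) (?\<theta> x))"
      unfolding F(3) by (simp add: fs.representation_zero)
    also have "\<dots> = (\<Sum>x\<in>F. ?r (scl (c x) (?\<theta> x)))"
    proof -
      have "fs.representation (eta ` odd_vcomps l) (\<Sum>x\<in>F. scl (c x) (?\<theta> x)) =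
          (\<lambda>b. \<Sum>x\<in>F. fs.representation (eta ` odd_vcomps l) (scl (c x) (?\<theta> x)) b)"
        by (rule fs.representation_sum[OF ind]) (intro fs.span_scale span)
      then show ?thesis
        by (rule fun_cong)
    qed
    also have "\<dots> = (\<Sum>x\<in>F. if x = y then c y * (- 1) ^ card T else 0)"
    proof (intro sum.cong refl)
      fix x assume x: "x \<in> F"
      obtain S u where Su: "x = (S, u)"
        by fastforce
      have admS: "(S, u) \<in> admissible l"
        using x F(2) Su by blast
      have finS: "finite S"
        using admissible_odd_vcomps(3)[OF admS] finite_Pk by metis
      have "?r (scl (c x) (?\<theta> x)) = c x * ?r (theta S u)"
        by (subst fs.representation_scale[OF ind span[OF x]]) (simp add: Su)
      also have "\<dots> = c x * (if T \<subseteq> S \<and> u = v then (- 1) ^ card T else 0)"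
        by (simp only: representation_theta[OF admS adm])
      also have "\<dots> = (if x = y then c y * (- 1) ^ card T else 0)"
      proof (cases "c x = 0")
        case False
        then have "card S \<le> card T"
          using max[OF x] Su Tv by simp
        then have "T \<subseteq> S \<longleftrightarrow> T = S"
          using card_seteq[OF finS] by auto
        then show ?thesis
          using Su Tv by auto
      qed (use y(2) in auto)
      finally show "?r (scl (c x) (?\<theta> x)) = (if x = y then c y * (- 1) ^ card T else 0)" .
    qed
    also have "\<dots> = c y * (- 1) ^ card T"
      using F(1) y(1) by simp
    finally show False
      using y(2) by simp
  qed
  show "inj_on ?\<theta> (admissible l)" "fs.independent (?\<theta> ` admissible l)"
    by (rule independent_family[OF *]; assumption)+
qed

lemma span_theta: "fs.span ((\<lambda>(S, u). theta S u) ` admissible l) = eta_span l"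
proof
  show "fs.span ((\<lambda>(S, u). theta S u) ` admissible l) \<subseteq> eta_span l"
    using theta_in_eta_span by (intro fs.span_minimal) (auto simp: eta_span_def)
  have "eta K \<in> fs.span ((\<lambda>(S, u). theta S u) ` admissible l)" if K: "K \<in> odd_vcomps l" for K
    unfolding eta_eq_sum_theta[OF K]
  proof (intro fs.span_sum fs.span_scale fs.span_base)
    fix S assume "S \<in> Pow (Pk (tilde K))"
    then have "(S, cw K) \<in> admissible l"
      using odd_vcomps_tilde(1)[OF K] admissible_subset by blast
    then show "theta S (cw K) \<in> (\<lambda>(S, u). theta S u) ` admissible l"
      by (intro image_eqI[of _ _ "(S, cw K)"]) auto
  qed
  then show "eta_span l \<subseteq> fs.span ((\<lambda>(S, u). theta S u) ` admissible l)"
    unfolding eta_span_def by (intro fs.span_minimal fs.subspace_span) blast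
qed

theorem theorem6p7:
  fixes l :: nat
  assumes "l \<ge> 1"
  shows "inj_on (\<lambda>(S, u). theta S u) (admissible l) \<and>
     fs.independent ((\<lambda>(S, u). theta S u) ` admissible l) \<and>
     fs.span ((\<lambda>(S, u). theta S u) ` admissible l) = O_infty l \<and>
     (\<forall>I\<in>vcomps l. (\<forall>i\<in>set I. odd (wt i)) \<longrightarrow>
        eta I = (\<Sum>S\<in>Pow (Pk (tilde I)). scl ((- 1) ^ card S) (theta S (cw I)))) \<and>
     (\<forall>(S, u)\<in>admissible l.
        theta S u = (\<Sum>T\<in>Pow S. scl ((- 1) ^ card T) (eta (odd_comp (peak_comp T u)))))"
proof (intro conjI ballI impI)
  show "inj_on (\<lambda>(S, u). theta S u) (admissible l)"
    "fs.independent ((\<lambda>(S, u). theta S u) ` admissible l)"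
    by (rule theta_independent)+
  show "fs.span ((\<lambda>(S, u). theta S u) ` admissible l) = O_infty l"
    by (simp only: span_theta O_infty_eq)
next
  fix I assume "I \<in> vcomps l" "\<forall>i\<in>set I. odd (wt i)"
  then show "eta I = (\<Sum>S\<in>Pow (Pk (tilde I)). scl ((- 1) ^ card S) (theta S (cw I)))"
    by (intro eta_eq_sum_theta[of I l]) (simp add: odd_vcomps_def)
next
  fix x assume "x \<in> admissible l"
  then show "case x of (S, u) \<Rightarrow>
      theta S u = (\<Sum>T\<in>Pow S. scl ((- 1) ^ card T) (eta (odd_comp (peak_comp T u))))"
    using theta_eq_sum_eta by (cases x) blast
qed

end
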